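(* Let $s\in(0,1)$, $m>0$, $A\in C^2(\mathbb{R}^3,\mathbb{R}^3)$, let $f\in H^{-s}_A(\mathbb{R}^3,\mathbb{C})$, and let $u\in H^s_A(\mathbb{R}^3,\mathbb{C})$ be a weak solution to $$(-\Delta+m^2)^s_A u=f\quad\text{in }\mathbb{R}^3.$$ Assume that $u\in L^\infty(\mathbb{R}^3,\mathbb{C})\cap C^{1,\gamma}_{\mathrm{loc}}(\mathbb{R}^3,\mathbb{C})$ for some $\gamma\in(0,1]$ with $\gamma>2s-1$. Then $u$ solves the equation pointwise a.e. in $\mathbb{R}^3$, i.e. $(-\Delta+m^2)^s_A u(x)=f(x)$ for a.e. $x\in\mathbb{R}^3$.
   Context: $C_s:=\dfrac{s\,2^{\frac{2s-1}{2}}}{\pi^{3/2}\,\Gamma(1-s)}$, where $\Gamma$ is the Gamma function. $\mathcal{K}_\nu$ is the modified Bessel function (also called MacDonald function) of order $\nu$: $\mathcal{K}_\nu(\zeta)=\frac12\left(\frac{\zeta}{2}\right)^\nu\int_0^{+\infty}e^{-\frac{\zeta^2}{4t}-t}t^{-1-\nu}\,dt$ for $\zeta>0$. With $B^c_\varepsilon(x)=\{y\in\mathbb{R}^3:|x-y|\ge\varepsilon\}$, the pointwise operator is $$(-\Delta+m^2)^s_A u(x):=C_s m^{\frac{3+2s}{2}}\lim_{\varepsilon\searrow0}\int_{B^c_\varepsilon(x)}\frac{u(x)-e^{i(x-y)\cdot A\left(\frac{x+y}{2}\right)}u(y)}{|x-y|^{\frac{3+2s}{2}}}\,\mathcal{K}_{\frac{3+2s}{2}}(m|x-y|)\,dy+m^{2s}u(x).$$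 For measurable $u,v:\mathbb{R}^3\to\mathbb{C}$ put $$\langle u,v\rangle_{A,s}:=\Re\int_{\mathbb{R}^3\times\mathbb{R}^3}\frac{\left(e^{-i(x-y)\cdot A\left(\frac{x+y}{2}\right)}u(x)-u(y)\right)\overline{\left(e^{-i(x-y)\cdot A\left(\frac{x+y}{2}\right)}v(x)-v(y)\right)}}{|x-y|^{\frac{3+2s}{2}}}\,\mathcal{K}_{\frac{3+2s}{2}}(m|x-y|)\,dx\,dy,$$ $(u,v)_{A,s}:=\frac{C_s}{2}m^{\frac{3+2s}{2}}\langle u,v\rangle_{A,s}+m^{2s}\Re\int_{\mathbb{R}^3}u\overline{v}\,dx$ and $\|u\|_{A,s}:=\sqrt{(u,u)_{A,s}}$. $H^s_A(\mathbb{R}^3,\mathbb{C})$ is the closure of $C^\infty_c(\mathbb{R}^3,\mathbb{C})$ in $\mathcal{H}:=\{u:\mathbb{R}^3\to\mathbb{C}: (u,u)_{A,s}<+\infty\}$ with respect to $\|\cdot\|_{A,s}$, and $H^{-s}_A(\mathbb{R}^3,\mathbb{C})$ is its dual space. Here $f\in H^{-s}_A(\mathbb{R}^3,\mathbb{C})$ is a (locally integrable) function acting by $v\mapsto\Re\int_{\mathbb{R}^3}f\overline{v}\,dx$. $u\in H^s_A(\mathbb{R}^3,\mathbb{C})$ is a weak solution of $(-\Delta+m^2)^s_Au=f$ if $$(u,v)_{A,s}=\Re\int_{\mathbb{R}^3}f(x)\overline{v(x)}\,dx\quad\text{for every }v\in H^s_A(\mathbb{R}^3,\mathbb{C}).$$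 *)

theory Defs
  imports "HOL-Analysis.Analysis"
begin

section \<open>Classical regularity classes\<close>

primrec C_k :: "nat \<Rightarrow> ('a::euclidean_space \<Rightarrow> 'b::real_normed_vector) \<Rightarrow> bool" where
  "C_k 0 g \<longleftrightarrow> continuous_on UNIV g"
| "C_k (Suc k) g \<longleftrightarrow>
     (\<forall>x. g differentiable (at x)) \<and>
     (\<forall>b\<in>Basis. C_k k (\<lambda>x. frechet_derivative g (at x) b))"

definition test_functions :: "('a::euclidean_space \<Rightarrow> 'b::real_normed_vector) set" where
  "test_functions = {\<phi>. (\<forall>k. C_k k \<phi>) \<and> compact (closure {x. \<phi> x \<noteq> 0})}"

definition C1_loc_holder :: "real \<Rightarrow> ('a::euclidean_space \<Rightarrow> 'b::real_normed_vector) \<Rightarrow> bool" where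
  "C1_loc_holder \<gamma> g \<longleftrightarrow>
     C_k 1 g \<and>
     (\<forall>K. compact K \<longrightarrow>
        (\<exists>L. \<forall>b\<in>Basis. \<forall>x\<in>K. \<forall>y\<in>K.
           norm (frechet_derivative g (at x) b - frechet_derivative g (at y) b)
             \<le> L * dist x y powr \<gamma>))"

definition L_infinity :: "('a::euclidean_space \<Rightarrow> 'b::real_normed_vector) set" where
  "L_infinity = {g. g \<in> borel_measurable lebesgue \<and> (\<exists>M. AE x in lebesgue. norm (g x) \<le> M)}"

definition locally_integrable :: "('a::euclidean_space \<Rightarrow> 'b::euclidean_space) \<Rightarrow> bool" where
  "locally_integrable g \<longleftrightarrow> (\<forall>K. compact K \<longrightarrow> set_integrable lebesgue K g)"


section \<open>The pointwise operator\<close>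

definition Bessel_K :: "real \<Rightarrow> real \<Rightarrow> real" where
  "Bessel_K \<nu> \<zeta> =
     1 / 2 * (\<zeta> / 2) powr \<nu> *
     (LINT t:{0<..}|lborel. exp (- (\<zeta>\<^sup>2 / (4 * t)) - t) * t powr (- 1 - \<nu>))"

definition C_const :: "real \<Rightarrow> real" where
  "C_const s = s * 2 powr ((2 * s - 1) / 2) / (pi powr (3 / 2) * Gamma (1 - s))"

definition magnetic_phase :: "(real^3 \<Rightarrow> real^3) \<Rightarrow> real^3 \<Rightarrow> real^3 \<Rightarrow> real" where
  "magnetic_phase A x y = (x - y) \<bullet> A ((1 / 2) *\<^sub>R (x + y))"

text \<open>On the diagonal \<open>kernel s m x x = 0\<close> by the convention \<open>a / 0 = 0\<close>; the diagonal is a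
  null set of the product space and lies outside every domain \<open>- ball x \<epsilon>\<close>.\<close>

definition kernel :: "real \<Rightarrow> real \<Rightarrow> real^3 \<Rightarrow> real^3 \<Rightarrow> real" where
  "kernel s m x y =
     Bessel_K ((3 + 2 * s) / 2) (m * norm (x - y)) / norm (x - y) powr ((3 + 2 * s) / 2)"

definition operator_integrand ::
  "real \<Rightarrow> real \<Rightarrow> (real^3 \<Rightarrow> real^3) \<Rightarrow> (real^3 \<Rightarrow> complex) \<Rightarrow> real^3 \<Rightarrow> real^3 \<Rightarrow> complex" where
  "operator_integrand s m A u x y =
     (u x - cis (magnetic_phase A x y) * u y) * of_real (kernel s m x y)"

definition truncated_integral ::
  "real \<Rightarrow> real \<Rightarrow> (real^3 \<Rightarrow> real^3) \<Rightarrow> (real^3 \<Rightarrow> complex) \<Rightarrow> real^3 \<Rightarrow> real \<Rightarrow> complex" where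
  "truncated_integral s m A u x \<epsilon> = (LINT y:- ball x \<epsilon>|lebesgue. operator_integrand s m A u x y)"

text \<open>\<open>magnetic_operator\<close> is total, since \<open>Lim\<close> and the Bochner integral are;
  \<open>operator_defined_at\<close> says that its value at \<open>x\<close> is a genuine one.\<close>

definition operator_defined_at ::
  "real \<Rightarrow> real \<Rightarrow> (real^3 \<Rightarrow> real^3) \<Rightarrow> (real^3 \<Rightarrow> complex) \<Rightarrow> real^3 \<Rightarrow> bool" where
  "operator_defined_at s m A u x \<longleftrightarrow>
     (\<forall>\<epsilon>>0. set_integrable lebesgue (- ball x \<epsilon>) (operator_integrand s m A u x)) \<and>
     (\<exists>l. (truncated_integral s m A u x \<longlongrightarrow> l) (at_right 0))"

definition magnetic_operator ::
  "real \<Rightarrow> real \<Rightarrow> (real^3 \<Rightarrow> real^3) \<Rightarrow> (real^3 \<Rightarrow> complex) \<Rightarrow> real^3 \<Rightarrow> complex" where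
  "magnetic_operator s m A u x =
     of_real (C_const s * m powr ((3 + 2 * s) / 2))
       * Lim (at_right 0) (truncated_integral s m A u x)
     + of_real (m powr (2 * s)) * u x"


section \<open>The magnetic Sobolev space and its dual\<close>

text \<open>\<open>lebesgue\<close> on the product type is the completed product measure, so that all
  Lebesgue measurable functions \<open>u\<close>, \<open>v\<close> are admitted.\<close>

definition form_integrand ::
  "real \<Rightarrow> real \<Rightarrow> (real^3 \<Rightarrow> real^3) \<Rightarrow> (real^3 \<Rightarrow> complex) \<Rightarrow> (real^3 \<Rightarrow> complex)
    \<Rightarrow> (real^3) \<times> (real^3) \<Rightarrow> complex" where
  "form_integrand s m A u v = (\<lambda>(x, y).
     (cis (- magnetic_phase A x y) * u x - u y)
     * cnj (cis (- magnetic_phase A x y) * v x - v y)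
     * of_real (kernel s m x y))"

definition seminorm_form ::
  "real \<Rightarrow> real \<Rightarrow> (real^3 \<Rightarrow> real^3) \<Rightarrow> (real^3 \<Rightarrow> complex) \<Rightarrow> (real^3 \<Rightarrow> complex) \<Rightarrow> real" where
  "seminorm_form s m A u v = Re (LINT p|lebesgue. form_integrand s m A u v p)"

definition L2_pairing :: "(real^3 \<Rightarrow> complex) \<Rightarrow> (real^3 \<Rightarrow> complex) \<Rightarrow> real" where
  "L2_pairing u v = Re (LINT x|lebesgue. u x * cnj (v x))"

definition inner_As ::
  "real \<Rightarrow> real \<Rightarrow> (real^3 \<Rightarrow> real^3) \<Rightarrow> (real^3 \<Rightarrow> complex) \<Rightarrow> (real^3 \<Rightarrow> complex) \<Rightarrow> real" where
  "inner_As s m A u v =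
     C_const s / 2 * m powr ((3 + 2 * s) / 2) * seminorm_form s m A u v
     + m powr (2 * s) * L2_pairing u v"

definition norm_As :: "real \<Rightarrow> real \<Rightarrow> (real^3 \<Rightarrow> real^3) \<Rightarrow> (real^3 \<Rightarrow> complex) \<Rightarrow> real" where
  "norm_As s m A u = sqrt (inner_As s m A u u)"

text \<open>For \<open>v = u\<close> both integrands in \<open>inner_As\<close> are nonnegative, so that
  \<open>(u, u)\<^sub>A\<^sub>,\<^sub>s < \<infinity>\<close> means that both are integrable. The elements are functions, not
  classes modulo null sets.\<close>

definition finite_energy :: "real \<Rightarrow> real \<Rightarrow> (real^3 \<Rightarrow> real^3) \<Rightarrow> (real^3 \<Rightarrow> complex) set" where
  "finite_energy s m A =
     {u. u \<in> borel_measurable lebesgue \<and>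
         integrable lebesgue (form_integrand s m A u u) \<and>
         integrable lebesgue (\<lambda>x. u x * cnj (u x))}"

text \<open>Test functions have finite energy whenever \<open>A\<close> is regular, e.g. \<open>C\<^sup>2\<close>; the intersection
  below keeps \<open>u - \<phi>\<close> of finite energy for arbitrary \<open>A\<close>.\<close>

definition H_space :: "real \<Rightarrow> real \<Rightarrow> (real^3 \<Rightarrow> real^3) \<Rightarrow> (real^3 \<Rightarrow> complex) set" where
  "H_space s m A =
     {u \<in> finite_energy s m A.
        \<forall>e>0. \<exists>\<phi> \<in> test_functions \<inter> finite_energy s m A. norm_As s m A (\<lambda>x. u x - \<phi> x) < e}"

text \<open>Since \<open>inner_As\<close> is a real inner product, the dual consists of the bounded real-linear
  functionals; their values outside \<open>H_space\<close> are irrelevant.\<close>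

definition H_dual :: "real \<Rightarrow> real \<Rightarrow> (real^3 \<Rightarrow> real^3) \<Rightarrow> ((real^3 \<Rightarrow> complex) \<Rightarrow> real) set" where
  "H_dual s m A =
     {F. (\<forall>v\<in>H_space s m A. \<forall>w\<in>H_space s m A. F (\<lambda>x. v x + w x) = F v + F w) \<and>
         (\<forall>c. \<forall>v\<in>H_space s m A. F (\<lambda>x. c *\<^sub>R v x) = c * F v) \<and>
         (\<exists>B. \<forall>v\<in>H_space s m A. \<bar>F v\<bar> \<le> B * norm_As s m A v)}"

definition function_in_H_dual ::
  "real \<Rightarrow> real \<Rightarrow> (real^3 \<Rightarrow> real^3) \<Rightarrow> (real^3 \<Rightarrow> complex) \<Rightarrow> bool" where
  "function_in_H_dual s m A f \<longleftrightarrow>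
     locally_integrable f \<and>
     (\<forall>v\<in>H_space s m A. integrable lebesgue (\<lambda>x. f x * cnj (v x))) \<and>
     L2_pairing f \<in> H_dual s m A"

definition weak_solution ::
  "real \<Rightarrow> real \<Rightarrow> (real^3 \<Rightarrow> real^3) \<Rightarrow> (real^3 \<Rightarrow> complex) \<Rightarrow> (real^3 \<Rightarrow> complex) \<Rightarrow> bool" where
  "weak_solution s m A f u \<longleftrightarrow>
     u \<in> H_space s m A \<and>
     (\<forall>v\<in>H_space s m A. inner_As s m A u v = L2_pairing f v)"

end

theory Submission
  imports Defs
begin

text \<open>Why the theorem holds. For a test function \<open>v\<close> the integrand of the form \<open>\<langle>u, v\<rangle>\<close> is the sum of
  the operator integrand at \<open>(x, y)\<close> times \<open>cnj (v x)\<close> and the same term with \<open>x\<close> and \<open>y\<close> exchanged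
  (\<open>form_integrand_eq_operator_integrand\<close>). Cut off at distance \<open>\<epsilon>\<close> from the diagonal, both terms are integrable
  and Fubini turns the form into twice the pairing of \<open>v\<close> with the truncated integral. The form
  converges as \<open>\<epsilon>\<close> tends to \<open>0\<close>, since \<open>u\<close> and \<open>v\<close> have finite energy. The
  heart of the matter is the convergence of the truncated integral, pointwise and boundedly on compact sets.

  The kernel, a Bessel function of order \<open>(3 + 2 s) / 2\<close> divided by that power of \<open>r\<close>, behaves like
  \<open>r powr (- (3 + 2 s))\<close> at \<open>0\<close>; a first difference of \<open>u\<close>, of order \<open>r\<close>, does not compensate this
  when \<open>s \<ge> 1/2\<close>. But the domain of truncation is symmetric about \<open>x\<close>, so one may average over \<open>x + z\<close>
  and \<open>x - z\<close>. Then linear terms cancel, both those of \<open>u\<close> and those of the magnetic phase, and the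
  remaining second difference is of order \<open>r powr (1 + \<gamma>)\<close> (\<open>magnetic_second_difference\<close>). The
  condition \<open>\<gamma> > 2 s - 1\<close> makes the product with the kernel integrable
  (\<open>symmetric_difference_dominated\<close>), and dominated convergence gives the limit.

  Hence the pointwise operator applied to \<open>u\<close>, minus \<open>f\<close>, is locally integrable and orthogonal to all test functions
  (\<open>seminorm_form_test_function\<close>; test functions belong to the energy space by
  \<open>test_functions_finite_energy\<close>). By \<open>fundamental_lemma\<close> it vanishes almost everywhere.\<close>

section \<open>The size of the Bessel kernel\<close>

lemma borel_measurable_Bessel_K [measurable]: "Bessel_K \<nu> \<in> borel_measurable borel"
  unfolding Bessel_K_def [abs_def] set_lebesgue_integral_def
  by measurable

lemma Bessel_K_nonneg: "0 \<le> Bessel_K \<nu> \<zeta>"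
  unfolding Bessel_K_def set_lebesgue_integral_def
  by (intro mult_nonneg_nonneg integral_nonneg) (auto simp: indicator_def)

lemma power_div_fact_le_exp:
  fixes x :: real
  assumes "0 \<le> x"
  shows "x ^ n / fact n \<le> exp x"
proof -
  have "(\<Sum>k\<in>{n}. x ^ k /\<^sub>R fact k) \<le> (\<Sum>k. x ^ k /\<^sub>R fact k)"
    using exp_converges[of x] assms by (intro sum_le_suminf) (auto simp: sums_iff)
  thus ?thesis using exp_converges[of x] by (simp add: sums_iff field_simps)
qed

text \<open>Near \<open>0\<close> the exponential beats every power of \<open>\<tau>\<close>; at infinity the power alone is integrable.
  This integral is the constant in the bound for \<open>Bessel_K\<close> below.\<close>

lemma integrable_exp_inverse_powr:
  fixes \<nu> :: real
  assumes "0 < \<nu>"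
  shows "set_integrable lborel {0<..} (\<lambda>\<tau>. exp (- (1 / (4 * \<tau>))) * \<tau> powr (- 1 - \<nu>))"
proof -
  let ?f = "\<lambda>\<tau>::real. exp (- (1 / (4 * \<tau>))) * \<tau> powr (- 1 - \<nu>)"
  \<comment> \<open>The exponential series dominates its \<open>n\<close>-th term, and \<open>n\<close> powers of \<open>\<tau>\<close> compensate the singularity.\<close>
  obtain n :: nat where n: "1 + \<nu> \<le> real n" using real_arch_simple by blast
  let ?C = "fact n * 4 ^ n :: real"
  have small: "norm (?f \<tau>) \<le> ?C" if "0 < \<tau>" "\<tau> \<le> 1" for \<tau>
  proof -
    have "(1 / (4 * \<tau>)) ^ n / fact n \<le> exp (1 / (4 * \<tau>))"
      using that by (intro power_div_fact_le_exp) auto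
    hence "exp (- (1 / (4 * \<tau>))) \<le> ?C * \<tau> ^ n"
      using that by (simp add: exp_minus divide_simps power_mult_distrib mult_ac)
    moreover have "\<tau> powr (- 1 - \<nu>) \<le> \<tau> powr (- real n)"
      using that n by (intro powr_mono') auto
    ultimately have "?f \<tau> \<le> (?C * \<tau> ^ n) * \<tau> powr (- real n)"
      using that by (intro mult_mono) auto
    also have "\<dots> = ?C"
      using that by (simp add: powr_minus powr_realpow)
    finally show ?thesis by (simp)
  qed
  have "integrable lborel (\<lambda>\<tau>. indicator {0<..1} \<tau> *\<^sub>R ?C + indicator {1..} \<tau> *\<^sub>R \<tau> powr (- 1 - \<nu>))"
  proof (intro Bochner_Integration.integrable_add)
    show "integrable lborel (\<lambda>\<tau>::real. indicator {0<..1} \<tau> *\<^sub>R ?C)" by simp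
    have "(\<lambda>\<tau>. \<tau> powr (- 1 - \<nu>)) integrable_on {1..}"
      using has_integral_powr_to_inf[of "- 1 - \<nu>" 1] assms by (auto simp: integrable_on_def)
    hence "(\<lambda>\<tau>. \<tau> powr (- 1 - \<nu>)) absolutely_integrable_on {1..}"
      by (intro nonnegative_absolutely_integrable_1) auto
    thus "integrable lborel (\<lambda>\<tau>. indicator {1..} \<tau> *\<^sub>R \<tau> powr (- 1 - \<nu>))"
      unfolding set_integrable_def by (subst (asm) integrable_completion) auto
  qed
  thus ?thesis unfolding set_integrable_def
  proof (rule Bochner_Integration.integrable_bound)
    show "AE \<tau> in lborel. norm (indicator {0<..} \<tau> *\<^sub>R ?f \<tau>) \<le>
        norm (indicator {0<..1} \<tau> *\<^sub>R ?C + indicator {1..} \<tau> *\<^sub>R \<tau> powr (- 1 - \<nu>))"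
    proof (rule AE_I2)
      fix \<tau> :: real
      have "?f \<tau> \<le> \<tau> powr (- 1 - \<nu>)" if "1 \<le> \<tau>"
        using that by (simp add: mult_left_le_one_le)
      thus "norm (indicator {0<..} \<tau> *\<^sub>R ?f \<tau>) \<le>
        norm (indicator {0<..1} \<tau> *\<^sub>R ?C + indicator {1..} \<tau> *\<^sub>R \<tau> powr (- 1 - \<nu>))"
        using small[of \<tau>] by (cases "\<tau> = 1") (auto simp: indicator_def abs_mult)
    qed
  qed measurable
qed

text \<open>The scaling \<open>t = \<zeta>\<^sup>2 \<tau>\<close> extracts the factor \<open>\<zeta> powr (- 2 * \<nu>)\<close> from the defining integral;
  the remaining integrand is bounded uniformly in \<open>\<zeta>\<close> because \<open>exp (- \<zeta>\<^sup>2 \<tau>) \<le> 1\<close>. This is the sharp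
  order at \<open>\<zeta> = 0\<close>. At infinity it forgets the exponential decay, but for \<open>\<nu> = (3 + 2 s) / 2\<close>
  the kernel is left with the power \<open>- 2 * \<nu> < - 3\<close>, which is integrable there.\<close>

lemma Bessel_K_le:
  fixes \<nu> :: real
  assumes "0 < \<nu>"
  shows "\<exists>C\<ge>0. \<forall>\<zeta>>0. Bessel_K \<nu> \<zeta> \<le> C * \<zeta> powr (- \<nu>)"
proof -
  let ?f = "\<lambda>\<tau>::real. exp (- (1 / (4 * \<tau>))) * \<tau> powr (- 1 - \<nu>)"
  define J where "J = (\<integral>\<tau>. indicator {0<..} \<tau> *\<^sub>R ?f \<tau> \<partial>lborel)"
  have J0: "0 \<le> J" unfolding J_def by (intro Bochner_Integration.integral_nonneg) (auto simp: indicator_def)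
  have bound: "Bessel_K \<nu> \<zeta> \<le> (1/2 * (1/2) powr \<nu> * J) * \<zeta> powr (- \<nu>)" if z: "0 < \<zeta>" for \<zeta>
  proof -
    let ?g = "\<lambda>t. indicator {0<..} t *\<^sub>R (exp (- (\<zeta>\<^sup>2 / (4 * t)) - t) * t powr (- 1 - \<nu>))"
    have "(\<integral>t. ?g t \<partial>lborel) = \<bar>\<zeta>\<^sup>2\<bar> *\<^sub>R (\<integral>\<tau>. ?g (0 + \<zeta>\<^sup>2 * \<tau>) \<partial>lborel)"
      using z by (intro lborel_integral_real_affine) auto
    also have "\<dots> \<le> \<bar>\<zeta>\<^sup>2\<bar> *\<^sub>R (\<integral>\<tau>. \<zeta> powr (-2 - 2 * \<nu>) * (indicator {0<..} \<tau> *\<^sub>R ?f \<tau>) \<partial>lborel)"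
    proof (intro scaleR_left_mono integral_mono')
      show "integrable lborel (\<lambda>\<tau>. \<zeta> powr (-2 - 2 * \<nu>) * (indicator {0<..} \<tau> *\<^sub>R ?f \<tau>))"
        using integrable_exp_inverse_powr[OF assms] unfolding set_integrable_def
        by (intro integrable_mult_right)
      fix \<tau> :: real
      show "?g (0 + \<zeta>\<^sup>2 * \<tau>) \<le> \<zeta> powr (-2 - 2 * \<nu>) * (indicator {0<..} \<tau> *\<^sub>R ?f \<tau>)"
      proof (cases "0 < \<tau>")
        case True
        have "(\<zeta>\<^sup>2 * \<tau>) powr (- 1 - \<nu>) = \<zeta> powr (-2 - 2 * \<nu>) * \<tau> powr (- 1 - \<nu>)"
          using z True by (simp add: powr_mult powr_powr flip: powr_numeral)
        moreover have "exp (- (1 / (4 * \<tau>)) - \<zeta>\<^sup>2 * \<tau>) \<le> exp (- (1 / (4 * \<tau>)))"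
          using True by simp
        moreover have "\<zeta>\<^sup>2 / (4 * (\<zeta>\<^sup>2 * \<tau>)) = 1 / (4 * \<tau>)" using z by simp
        ultimately show ?thesis using True z
          by (simp add: mult_ac mult_left_mono del: exp_le_cancel_iff)
      qed (auto simp: indicator_def z zero_less_mult_iff)
    qed (auto simp: indicator_def)
    also have "\<dots> = \<zeta>\<^sup>2 * \<zeta> powr (-2 - 2 * \<nu>) * J" unfolding J_def by simp
    also have "\<zeta>\<^sup>2 * \<zeta> powr (-2 - 2 * \<nu>) = \<zeta> powr (- 2 * \<nu>)"
      using z by (simp flip: powr_add powr_numeral)
    finally have "Bessel_K \<nu> \<zeta> \<le> 1/2 * (\<zeta>/2) powr \<nu> * (\<zeta> powr (- 2 * \<nu>) * J)"
      unfolding Bessel_K_def set_lebesgue_integral_def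
      using z by (intro mult_left_mono) auto
    also have "(\<zeta>/2) powr \<nu> = \<zeta> powr \<nu> * (1/2) powr \<nu>"
      using z powr_mult[of \<zeta> "1/2" \<nu>] by simp
    also have "1/2 * (\<zeta> powr \<nu> * (1/2) powr \<nu>) * (\<zeta> powr (- 2 * \<nu>) * J)
        = (1/2 * (1/2) powr \<nu> * J) * (\<zeta> powr \<nu> * \<zeta> powr (- 2 * \<nu>))" by (simp add: mult_ac)
    also have "\<zeta> powr \<nu> * \<zeta> powr (- 2 * \<nu>) = \<zeta> powr (- \<nu>)" by (simp flip: powr_add)
    finally show ?thesis .
  qed
  show ?thesis
    by (rule exI[of _ "1/2 * (1/2) powr \<nu> * J"]) (use bound J0 in auto)
qed

text \<open>The kernel depends on \<open>x - y\<close> only; it is written as an even function of \<open>z = x - y\<close> so that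
  translations and reflections can be used.\<close>

definition radial_kernel :: "real \<Rightarrow> real \<Rightarrow> real^3 \<Rightarrow> real" where
  "radial_kernel s m z = kernel s m z 0"

lemma kernel_eq_radial_kernel: "kernel s m x y = radial_kernel s m (x - y)"
  by (simp add: radial_kernel_def kernel_def)

lemma radial_kernel_minus: "radial_kernel s m (- z) = radial_kernel s m z"
  by (simp add: radial_kernel_def kernel_def)

lemma radial_kernel_zero [simp]: "radial_kernel s m 0 = 0"
  by (simp add: radial_kernel_def kernel_def)

lemma borel_measurable_radial_kernel [measurable]: "radial_kernel s m \<in> borel_measurable borel"
  unfolding radial_kernel_def[abs_def] kernel_def by measurable

lemma radial_kernel_nonneg: "0 \<le> radial_kernel s m z"
  by (simp add: radial_kernel_def kernel_def Bessel_K_nonneg)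

text \<open>The operator is at most as singular as the fractional Laplacian of order \<open>s\<close>.\<close>

lemma radial_kernel_le:
  assumes "0 < s" "0 < m"
  shows "\<exists>C\<ge>0. \<forall>z. radial_kernel s m z \<le> C * norm z powr (- (3 + 2 * s))"
proof -
  let ?\<nu> = "(3 + 2 * s) / 2"
  obtain C where C: "C \<ge> 0" "\<And>\<zeta>. \<zeta> > 0 \<Longrightarrow> Bessel_K ?\<nu> \<zeta> \<le> C * \<zeta> powr (- ?\<nu>)"
    using Bessel_K_le[of ?\<nu>] assms by auto
  have "radial_kernel s m z \<le> (C * m powr (- ?\<nu>)) * norm z powr (- (3 + 2 * s))" for z :: "real^3"
  proof (cases "z = 0")
    case False
    have "radial_kernel s m z \<le> C * (m * norm z) powr (- ?\<nu>) / norm z powr ?\<nu>"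
      unfolding radial_kernel_def kernel_def using False assms C(2)[of "m * norm z"]
      by (simp add: divide_right_mono)
    also have "\<dots> = (C * m powr (- ?\<nu>)) * (norm z powr (- ?\<nu>) * norm z powr (- ?\<nu>))"
      using assms by (simp add: powr_mult powr_minus divide_simps)
    also have "norm z powr (- ?\<nu>) * norm z powr (- ?\<nu>) = norm z powr (- (3 + 2 * s))"
      by (simp flip: powr_add add: add_divide_distrib)
    finally show ?thesis .
  qed simp
  thus ?thesis using C(1) by (intro exI[of _ "C * m powr (- ?\<nu>)"]) auto
qed

section \<open>Integrability of powers of the norm\<close>

lemma integrable_abs_powr_near_0:
  fixes a :: real
  assumes "a < 1"
  shows "integrable lborel (\<lambda>t. indicator {-1..1} t * \<bar>t\<bar> powr (- a))"
proof -
  let ?g = "\<lambda>t::real. indicator {0..1} t * t powr (- a)"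
  have "(\<lambda>t. t powr (- a)) absolutely_integrable_on {0..1}"
    using has_integral_powr_from_0[of "- a" 1] assms
    by (intro nonnegative_absolutely_integrable_1) (auto simp: integrable_on_def)
  hence g: "integrable lborel ?g"
    unfolding set_integrable_def by (subst (asm) integrable_completion) (auto simp: mult_ac)
  hence "integrable lborel (\<lambda>t. ?g t + ?g (0 + (-1) * t))"
    by (intro Bochner_Integration.integrable_add lborel_integrable_real_affine) auto
  thus ?thesis
    by (rule Bochner_Integration.integrable_bound) (auto simp: indicator_def)
qed

lemma integrable_max_abs_powr:
  fixes a e :: real
  assumes "1 < a" "0 < e"
  shows "integrable lborel (\<lambda>t. (max e \<bar>t\<bar>) powr (- a))"
proof -
  let ?g = "\<lambda>t::real. indicator {e..} t * t powr (- a)"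
  have "(\<lambda>t. t powr (- a)) absolutely_integrable_on {e..}"
    using has_integral_powr_to_inf[of "- a" e] assms
    by (intro nonnegative_absolutely_integrable_1) (auto simp: integrable_on_def)
  hence g: "integrable lborel ?g"
    unfolding set_integrable_def by (subst (asm) integrable_completion) (auto simp: mult_ac)
  hence "integrable lborel (\<lambda>t. indicator {-e..e} t * e powr (- a) + (?g t + ?g (0 + (-1) * t)))"
    by (intro Bochner_Integration.integrable_add lborel_integrable_real_affine) (use assms in simp_all)
  thus ?thesis
    by (rule Bochner_Integration.integrable_bound) (use assms in \<open>auto simp: indicator_def max_def\<close>)
qed

text \<open>Integrals of radial powers are reduced to one dimension without polar coordinates: a power of
  the norm is the product over the coordinate directions of its \<open>DIM('a)\<close>-th root, and each factor
  is bounded by a function of one coordinate, since \<open>\<bar>z \<bullet> b\<bar> \<le> norm z\<close>.\<close>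

lemma integrable_bounded_by_Basis_product:
  fixes F :: "'a::euclidean_space \<Rightarrow> real" and f :: "real \<Rightarrow> real"
  assumes [measurable]: "F \<in> borel_measurable borel" and f: "integrable lborel f"
    and nonneg: "\<And>t. 0 \<le> f t" "\<And>z. 0 \<le> F z"
    and le: "AE z in lborel. F z \<le> (\<Prod>b\<in>Basis. f (z \<bullet> b))"
  shows "integrable lborel F"
proof (rule integrableI_nonneg)
  have [measurable]: "f \<in> borel_measurable borel" using f by auto
  have "(\<integral>\<^sup>+z. ennreal (F z) \<partial>lborel) \<le> (\<integral>\<^sup>+(z::'a). (\<Prod>b\<in>Basis. ennreal (f (z \<bullet> b))) \<partial>lborel)"
    by (rule nn_integral_mono_AE, use le in eventually_elim) (simp add: prod_ennreal nonneg ennreal_leI)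
  also have "\<dots> = (\<Prod>b\<in>(Basis::'a set). (\<integral>\<^sup>+t. ennreal (f t) \<partial>lborel))"
    by (rule nn_integral_lborel_prod) simp_all
  also have "\<dots> = (\<Prod>b\<in>(Basis::'a set). ennreal (\<integral>t. f t \<partial>lborel))"
    by (subst nn_integral_eq_integral[OF f]) (simp_all add: nonneg)
  also have "\<dots> = ennreal (\<Prod>b\<in>(Basis::'a set). (\<integral>t. f t \<partial>lborel))"
    by (intro prod_ennreal Bochner_Integration.integral_nonneg nonneg)
  also have "\<dots> < \<infinity>" by simp
  finally show "(\<integral>\<^sup>+z. ennreal (F z) \<partial>lborel) < \<infinity>" .
qed (use nonneg in auto)

lemma norm_powr_eq_Basis_product:
  fixes z :: "'a::euclidean_space"
  shows "z \<noteq> 0 \<Longrightarrow> norm z powr (- p) = (\<Prod>b\<in>(Basis::'a set). norm z powr (- (p / DIM('a))))"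
  by (simp add: powr_power)


text \<open>The coordinate bound \<open>norm z powr (- a) \<le> \<bar>z \<bullet> b\<bar> powr (- a)\<close> needs \<open>z \<bullet> b \<noteq> 0\<close>, because
  \<open>0 powr _ = 0\<close>; this excludes only a null set.\<close>

lemma integrable_norm_powr_near_0:
  fixes p :: real
  assumes "0 \<le> p" "p < DIM('a::euclidean_space)"
  shows "integrable lborel (\<lambda>z::'a. indicator (cball 0 1) z * norm z powr (- p))" (is "integrable _ ?F")
proof (rule integrable_bounded_by_Basis_product)
  let ?a = "p / DIM('a)"
  show "integrable lborel (\<lambda>t. indicator {-1..1} t * \<bar>t\<bar> powr (- ?a))"
    using assms by (intro integrable_abs_powr_near_0) (simp add: divide_less_eq)
  have "AE z::'a in lborel. \<forall>b\<in>Basis. z \<bullet> b \<noteq> 0"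
    by (intro AE_finite_allI AE_lborel_inner_neq) auto
  thus "AE z::'a in lborel. indicator (cball 0 1) z * norm z powr (- p)
      \<le> (\<Prod>b\<in>Basis. indicator {-1..1} (z \<bullet> b) * \<bar>z \<bullet> b\<bar> powr (- ?a))"
  proof eventually_elim
    case (elim z)
    have z0: "z \<noteq> 0" using elim nonempty_Basis by (metis ex_in_conv inner_zero_left)
    show ?case
    proof (cases "z \<in> cball 0 1")
      case True
      have "norm z powr (- p) \<le> (\<Prod>b\<in>Basis. indicator {-1..1} (z \<bullet> b) * \<bar>z \<bullet> b\<bar> powr (- ?a))"
        
      proof (subst norm_powr_eq_Basis_product[OF z0], intro prod_mono conjI)
        fix b :: 'a assume b: "b \<in> Basis"
        have le: "\<bar>z \<bullet> b\<bar> \<le> norm z" using b by (rule Basis_le_norm)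
        have "norm z \<le> 1" using True by simp
        with le have "z \<bullet> b \<in> {-1..1}" by (simp add: abs_le_iff)
        moreover have "norm z powr (- ?a) \<le> \<bar>z \<bullet> b\<bar> powr (- ?a)"
          using le elim b assms(1) by (intro powr_mono2') auto
        ultimately show "norm z powr (- ?a) \<le> indicator {-1..1} (z \<bullet> b) * \<bar>z \<bullet> b\<bar> powr (- ?a)"
          by simp
      qed simp
      thus ?thesis using True by simp
    qed (simp add: prod_nonneg)
  qed
  have [measurable]: "cball (0::'a) 1 \<in> sets borel" by simp
  show "?F \<in> borel_measurable borel" by measurable
qed simp_all

lemma integrable_norm_powr_at_infinity:
  fixes q e :: real
  assumes "DIM('a::euclidean_space) < q" "0 < e"
  shows "integrable lborel (\<lambda>z::'a. indicator (- ball 0 e) z * norm z powr (- q))" (is "integrable _ ?F")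
proof (rule integrable_bounded_by_Basis_product)
  let ?a = "q / DIM('a)"
  show "integrable lborel (\<lambda>t. (max e \<bar>t\<bar>) powr (- ?a))"
    using assms by (intro integrable_max_abs_powr) (simp_all add: less_divide_eq)
  have "0 < q" using assms(1) of_nat_0_le_iff[of "DIM('a)", where ?'a = real] by linarith
  have "indicator (- ball 0 e) z * norm z powr (- q) \<le> (\<Prod>b\<in>Basis. (max e \<bar>z \<bullet> b\<bar>) powr (- ?a))" for z :: 'a
  proof (cases "z \<in> ball 0 e")
    case False
    hence z0: "z \<noteq> 0" using assms by auto
    have "norm z powr (- q) \<le> (\<Prod>b\<in>Basis. (max e \<bar>z \<bullet> b\<bar>) powr (- ?a))"
      
    proof (subst norm_powr_eq_Basis_product[OF z0], intro prod_mono conjI)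
      fix b :: 'a assume "b \<in> Basis"
      hence "max e \<bar>z \<bullet> b\<bar> \<le> norm z" using False Basis_le_norm[of b z] by simp
      thus "norm z powr (- ?a) \<le> max e \<bar>z \<bullet> b\<bar> powr (- ?a)"
        using \<open>0 < q\<close> assms(2) by (intro powr_mono2') auto
    qed simp
    thus ?thesis using False by simp
  qed (simp add: prod_nonneg)
  thus "AE z::'a in lborel. indicator (- ball 0 e) z * norm z powr (- q)
      \<le> (\<Prod>b\<in>Basis. (max e \<bar>z \<bullet> b\<bar>) powr (- ?a))" by simp
  show "?F \<in> borel_measurable borel" by measurable
qed simp_all

section \<open>Difference estimates for continuously differentiable functions\<close>

lemma C_k_Suc_D: "C_k (Suc k) g \<Longrightarrow> C_k k g"
proof (induction k arbitrary: g)
  case 0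
  thus ?case
    by (auto intro!: continuous_at_imp_continuous_on differentiable_imp_continuous_within)
qed auto

lemma C_k_imp_continuous_on: "C_k k g \<Longrightarrow> continuous_on UNIV g"
  by (induction k) (use C_k_Suc_D in \<open>auto simp del: C_k.simps(2)\<close>)

lemma continuous_on_UNIV_bounded_on_cball:
  fixes g :: "'a::euclidean_space \<Rightarrow> 'b::real_normed_vector"
  assumes "continuous_on UNIV g"
  shows "\<exists>B. \<forall>x\<in>cball 0 R. norm (g x) \<le> B"
proof -
  have "compact (g ` cball 0 R)"
    by (intro compact_continuous_image continuous_on_subset[OF assms]) auto
  from compact_imp_bounded[OF this] show ?thesis by (auto simp: bounded_iff)
qed

lemma norm_linear_le_Basis_sum:
  fixes F :: "'a::euclidean_space \<Rightarrow> 'b::real_normed_vector"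
  assumes "linear F"
  shows "norm (F h) \<le> norm h * (\<Sum>b\<in>Basis. norm (F b))"
proof -
  have "F h = F (\<Sum>b\<in>Basis. (h \<bullet> b) *\<^sub>R b)" by (simp add: euclidean_representation)
  also have "\<dots> = (\<Sum>b\<in>Basis. (h \<bullet> b) *\<^sub>R F b)"
    using assms by (simp add: linear_sum linear_scale)
  also have "norm \<dots> \<le> (\<Sum>b\<in>Basis. norm h * norm (F b))"
    by (rule order_trans[OF norm_sum sum_mono]) (auto intro!: mult_right_mono Basis_le_norm)
  finally show ?thesis by (simp add: sum_distrib_left)
qed

lemma C_1_Lipschitz_on_cball:
  fixes g :: "'a::euclidean_space \<Rightarrow> 'b::real_normed_vector"
  assumes "C_k 1 g"
  shows "\<exists>L\<ge>0. \<forall>x\<in>cball 0 R. \<forall>y\<in>cball 0 R. norm (g x - g y) \<le> L * norm (x - y)"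
proof -
  have diff: "\<And>x. g differentiable (at x)"
    and cont: "\<And>b. b \<in> Basis \<Longrightarrow> continuous_on UNIV (\<lambda>x. frechet_derivative g (at x) b)"
    using assms by auto
  have "\<forall>b\<in>Basis. \<exists>B. \<forall>x\<in>cball 0 R. norm (frechet_derivative g (at x) b) \<le> B"
    using continuous_on_UNIV_bounded_on_cball[OF cont] by blast
  then obtain B where B: "\<And>b x. b \<in> Basis \<Longrightarrow> x \<in> cball 0 R \<Longrightarrow> norm (frechet_derivative g (at x) b) \<le> B b"
    by metis
  let ?L = "\<Sum>b\<in>Basis. \<bar>B b\<bar>"
  have "norm (g x - g y) \<le> ?L * norm (x - y)" if "x \<in> cball 0 R" "y \<in> cball 0 R" for x y
  proof (rule differentiable_bound[OF convex_cball _ _ that])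
    fix w :: 'a assume w: "w \<in> cball 0 R"
    show "(g has_derivative frechet_derivative g (at w)) (at w within cball 0 R)"
        by (rule has_derivative_at_withinI) (rule diff[of w, unfolded frechet_derivative_works])
    show "onorm (frechet_derivative g (at w)) \<le> ?L"
    proof (rule onorm_le)
      fix h
      have "norm (frechet_derivative g (at w) h)
          \<le> norm h * (\<Sum>b\<in>Basis. norm (frechet_derivative g (at w) b))"
        by (rule norm_linear_le_Basis_sum[OF linear_frechet_derivative[OF diff]])
      also have "\<dots> \<le> norm h * ?L"
        by (intro mult_left_mono sum_mono order_trans[OF B abs_ge_self] w) simp_all
      finally show "norm (frechet_derivative g (at w) h) \<le> ?L * norm h" by (simp add: mult_ac)
    qed
  qed
  thus ?thesis by (intro exI[of _ ?L]) (auto intro: sum_nonneg)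
qed

text \<open>On a second difference the linear terms cancel: the path \<open>t \<mapsto> g (x + t z) + g (x - t z)\<close> has
  derivative \<open>Dg (x + t z) z - Dg (x - t z) z\<close>, which is of size \<open>norm z * norm z powr \<gamma>\<close> by the
  Hoelder condition.\<close>

lemma C1_loc_holder_second_difference:
  fixes g :: "'a::euclidean_space \<Rightarrow> 'b::real_normed_vector"
  assumes "C1_loc_holder \<gamma> g" "0 < \<gamma>"
  shows "\<exists>C\<ge>0. \<forall>x\<in>cball 0 R. \<forall>z\<in>cball 0 1.
           norm (2 *\<^sub>R g x - g (x + z) - g (x - z)) \<le> C * norm z powr (1 + \<gamma>)"
proof -
  have diff: "\<And>x. g differentiable (at x)" using assms by (simp add: C1_loc_holder_def)
  obtain L where L: "\<And>b x y. b \<in> Basis \<Longrightarrow> x \<in> cball 0 (R + 1) \<Longrightarrow> y \<in> cball 0 (R + 1) \<Longrightarrow>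
      norm (frechet_derivative g (at x) b - frechet_derivative g (at y) b) \<le> L * dist x y powr \<gamma>"
  proof -
    have "\<exists>L. \<forall>b\<in>Basis. \<forall>x\<in>cball 0 (R + 1). \<forall>y\<in>cball 0 (R + 1).
        norm (frechet_derivative g (at x) b - frechet_derivative g (at y) b) \<le> L * dist x y powr \<gamma>"
      using assms(1) compact_cball[of "0::'a" "R + 1"] by (simp only: C1_loc_holder_def)
    thus ?thesis using that by metis
  qed
  define C where "C = DIM('a) * (\<bar>L\<bar> * 2 powr \<gamma>)"
  have "norm (2 *\<^sub>R g x - g (x + z) - g (x - z)) \<le> C * norm z powr (1 + \<gamma>)"
    if x: "x \<in> cball 0 R" and z: "z \<in> cball 0 1" for x z
  proof -
    define \<phi> where "\<phi> t = g (x + t *\<^sub>R z) + g (x - t *\<^sub>R z)" for t :: real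
    define D where "D t = frechet_derivative g (at (x + t *\<^sub>R z)) z
        - frechet_derivative g (at (x - t *\<^sub>R z)) z" for t :: real
    have "norm (\<phi> 1 - \<phi> 0) \<le> (C * norm z powr (1 + \<gamma>)) * norm (1 - 0 :: real)"
    proof (rule differentiable_bound[where S = "{0..1}" and f' = "\<lambda>t h. h *\<^sub>R D t"])
      fix t :: real assume t: "t \<in> {0..1}"
      have lin: "linear (frechet_derivative g (at y))" for y
        using diff by (rule linear_frechet_derivative)
      have Dg: "(g has_derivative frechet_derivative g (at y)) (at y)" for y
        by (rule diff[of y, unfolded frechet_derivative_works])
      have "((\<lambda>t. g (x + t *\<^sub>R z)) has_derivative
          (\<lambda>h. frechet_derivative g (at (x + t *\<^sub>R z)) (h *\<^sub>R z))) (at t)"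
        by (rule has_derivative_compose[where f = "\<lambda>t. x + t *\<^sub>R z", OF _ Dg])
           (auto intro!: derivative_eq_intros)
      moreover have "((\<lambda>t. g (x - t *\<^sub>R z)) has_derivative
          (\<lambda>h. frechet_derivative g (at (x - t *\<^sub>R z)) (- (h *\<^sub>R z)))) (at t)"
        by (rule has_derivative_compose[where f = "\<lambda>t. x - t *\<^sub>R z", OF _ Dg])
           (auto intro!: derivative_eq_intros)
      ultimately have "(\<phi> has_derivative (\<lambda>h. frechet_derivative g (at (x + t *\<^sub>R z)) (h *\<^sub>R z)
          + frechet_derivative g (at (x - t *\<^sub>R z)) (- (h *\<^sub>R z)))) (at t)"
        unfolding \<phi>_def by (rule has_derivative_add)
      moreover have "(\<lambda>h. frechet_derivative g (at (x + t *\<^sub>R z)) (h *\<^sub>R z)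
          + frechet_derivative g (at (x - t *\<^sub>R z)) (- (h *\<^sub>R z))) = (\<lambda>h. h *\<^sub>R D t)"
        using lin by (simp add: fun_eq_iff D_def linear_scale linear_neg scaleR_diff_right)
      ultimately show "(\<phi> has_derivative (\<lambda>h. h *\<^sub>R D t)) (at t within {0..1})"
        by (auto intro: has_derivative_at_withinI)
      have tz: "norm (t *\<^sub>R z) \<le> norm z"
        using t by (simp add: mult_left_le_one_le)
      have mem: "x + t *\<^sub>R z \<in> cball 0 (R + 1)" "x - t *\<^sub>R z \<in> cball 0 (R + 1)"
        using x z tz norm_triangle_ineq[of x "t *\<^sub>R z"] norm_triangle_ineq4[of x "t *\<^sub>R z"] by auto
      have "linear (\<lambda>h. frechet_derivative g (at (x + t *\<^sub>R z)) h - frechet_derivative g (at (x - t *\<^sub>R z)) h)"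
        using lin by (intro linear_compose_sub)
      hence "norm (D t) \<le> norm z * (\<Sum>b\<in>Basis. norm (frechet_derivative g (at (x + t *\<^sub>R z)) b
          - frechet_derivative g (at (x - t *\<^sub>R z)) b))"
        unfolding D_def by (rule norm_linear_le_Basis_sum)
      also have "\<dots> \<le> norm z * (\<Sum>b\<in>(Basis::'a set). \<bar>L\<bar> * 2 powr \<gamma> * norm z powr \<gamma>)"
      proof (intro mult_left_mono sum_mono)
        fix b :: 'a assume "b \<in> Basis"
        from L[OF this mem]
        have "norm (frechet_derivative g (at (x + t *\<^sub>R z)) b - frechet_derivative g (at (x - t *\<^sub>R z)) b)
            \<le> L * dist (x + t *\<^sub>R z) (x - t *\<^sub>R z) powr \<gamma>" .
        also have "dist (x + t *\<^sub>R z) (x - t *\<^sub>R z) = 2 * norm (t *\<^sub>R z)"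
          by (simp add: dist_norm abs_mult flip: scaleR_2)
        also have "L * (2 * norm (t *\<^sub>R z)) powr \<gamma> \<le> \<bar>L\<bar> * (2 * norm z) powr \<gamma>"
          using tz assms(2) by (intro mult_mono powr_mono2) auto
        finally show "norm (frechet_derivative g (at (x + t *\<^sub>R z)) b
            - frechet_derivative g (at (x - t *\<^sub>R z)) b) \<le> \<bar>L\<bar> * 2 powr \<gamma> * norm z powr \<gamma>"
          by (simp add: powr_mult mult_ac)
      qed simp
      also have "\<dots> = C * (norm z powr 1 * norm z powr \<gamma>)"
        by (simp add: C_def mult_ac)
      also have "\<dots> = C * norm z powr (1 + \<gamma>)" by (simp only: powr_add)
      finally have "norm (D t) \<le> C * norm z powr (1 + \<gamma>)" .
      thus "onorm (\<lambda>h. h *\<^sub>R D t) \<le> C * norm z powr (1 + \<gamma>)"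
        by (intro onorm_le) (simp add: mult.commute[of "\<bar>_\<bar>"] mult_right_mono)
    qed auto
    also have "\<phi> 1 - \<phi> 0 = - (2 *\<^sub>R g x - g (x + z) - g (x - z))"
      by (simp add: \<phi>_def scaleR_2)
    finally show ?thesis by (simp only: norm_minus_cancel) simp
  qed
  moreover have "C \<ge> 0" by (simp add: C_def)
  ultimately show ?thesis by blast
qed

section \<open>The magnetic second difference\<close>

lemma norm_cis_minus_1_le: "cmod (cis t - 1) \<le> 2 * \<bar>t\<bar>"
proof -
  have "\<bar>cos t - 1\<bar> = 2 * \<bar>sin (t/2)\<bar> * \<bar>sin (t/2)\<bar>"
    using cos_double_sin[of "t/2"] by (simp add: power2_eq_square abs_mult)
  also have "\<dots> \<le> 2 * \<bar>sin (t/2)\<bar> * 1" by (intro mult_left_mono) auto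
  also have "\<dots> \<le> \<bar>t\<bar>" using abs_sin_x_le_abs_x[of "t/2"] by simp
  finally have "\<bar>cos t - 1\<bar> \<le> \<bar>t\<bar>" .
  moreover have "cmod (cis t - 1) \<le> \<bar>cos t - 1\<bar> + \<bar>sin t\<bar>"
    using cmod_le[of "cis t - 1"] by simp
  ultimately show ?thesis using abs_sin_x_le_abs_x[of t] by linarith
qed

text \<open>For \<open>b\<close> close to \<open>- a\<close> the first order terms of the two phases cancel, which leaves a quadratic error.\<close>

lemma norm_cis_plus_cis_minus_2_le: "cmod (cis a + cis b - 2) \<le> \<bar>a + b\<bar> + (a\<^sup>2 + b\<^sup>2) / 2"
proof -
  have cos: "\<bar>cos t - 1\<bar> \<le> t\<^sup>2 / 2" for t :: real
  proof -
    have "\<bar>cos t - 1\<bar> = 2 * (sin (t/2))\<^sup>2" using cos_double_sin[of "t/2"] by simp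
    also have "\<dots> \<le> 2 * (t/2)\<^sup>2"
      using abs_sin_x_le_abs_x[of "t/2"] by (simp add: abs_le_square_iff[symmetric])
    finally show ?thesis by (simp add: power_divide)
  qed
  have "\<bar>sin a + sin b\<bar> = 2 * (\<bar>sin ((a + b)/2)\<bar> * \<bar>cos ((a - b)/2)\<bar>)"
    by (subst sin_plus_sin) (simp add: abs_mult)
  also have "\<dots> \<le> 2 * (\<bar>(a + b)/2\<bar> * 1)"
    by (intro mult_left_mono mult_mono abs_sin_x_le_abs_x) auto
  finally have "\<bar>sin a + sin b\<bar> \<le> \<bar>a + b\<bar>" by simp
  moreover have "cmod (cis a + cis b - 2) \<le> \<bar>cos a + cos b - 2\<bar> + \<bar>sin a + sin b\<bar>"
    using cmod_le[of "cis a + cis b - 2"] by simp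
  moreover have "\<bar>cos a + cos b - 2\<bar> \<le> a\<^sup>2/2 + b\<^sup>2/2" using cos[of a] cos[of b] by linarith
  ultimately show ?thesis by (simp add: add_divide_distrib)
qed

text \<open>The magnetic phase does not spoil the gain of the second difference. The phases at \<open>x + z\<close> and
  \<open>x - z\<close> are \<open>a = - z \<bullet> A (x + z/2)\<close> and \<open>b = z \<bullet> A (x - z/2)\<close>; their sum is \<open>O(norm z ^ 2)\<close> because
  \<open>A\<close> is locally Lipschitz, and each alone is \<open>O(norm z)\<close>. Everything except the plain second difference of
  \<open>u\<close> is therefore quadratic in \<open>z\<close>, and \<open>norm z ^ 2 \<le> norm z powr (1 + \<gamma>)\<close> on the unit ball.\<close>

lemma magnetic_second_difference:
  assumes A: "C_k 1 A" and u: "C1_loc_holder \<gamma> u" and \<gamma>: "0 < \<gamma>" "\<gamma> \<le> 1"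
  shows "\<exists>C\<ge>0. \<forall>x\<in>cball 0 R. \<forall>z\<in>cball 0 1.
     norm (2 * u x - cis (magnetic_phase A x (x + z)) * u (x + z)
                   - cis (magnetic_phase A x (x - z)) * u (x - z)) \<le> C * norm z powr (1 + \<gamma>)"
proof -
  have u1: "C_k 1 u" using u by (simp add: C1_loc_holder_def)
  obtain C0 where C0: "C0 \<ge> 0" "\<And>x z. x \<in> cball 0 R \<Longrightarrow> z \<in> cball 0 1 \<Longrightarrow>
     norm (2 *\<^sub>R u x - u (x + z) - u (x - z)) \<le> C0 * norm z powr (1 + \<gamma>)"
    using C1_loc_holder_second_difference[OF u \<gamma>(1), of R] by blast
  obtain L where L: "L \<ge> 0" "\<And>x y. x \<in> cball 0 (R+1) \<Longrightarrow> y \<in> cball 0 (R+1) \<Longrightarrow> norm (u x - u y) \<le> L * norm (x - y)"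
    using C_1_Lipschitz_on_cball[OF u1, of "R+1"] by blast
  obtain LA where LA: "LA \<ge> 0" "\<And>x y. x \<in> cball 0 (R+1) \<Longrightarrow> y \<in> cball 0 (R+1) \<Longrightarrow> norm (A x - A y) \<le> LA * norm (x - y)"
    using C_1_Lipschitz_on_cball[OF A, of "R+1"] by blast
  obtain M where M: "\<And>x. x \<in> cball 0 R \<Longrightarrow> norm (u x) \<le> M"
    using continuous_on_UNIV_bounded_on_cball[OF C_k_imp_continuous_on[OF u1]] by metis
  obtain MA where MA: "\<And>x. x \<in> cball 0 (R+1) \<Longrightarrow> norm (A x) \<le> MA"
    using continuous_on_UNIV_bounded_on_cball[OF C_k_imp_continuous_on[OF A]] by metis
  define C where "C = C0 + (LA + MA\<^sup>2) * \<bar>M\<bar> + 4 * \<bar>MA\<bar> * L"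
  have "C \<ge> 0" using C0 LA L by (simp add: C_def)
  moreover have "norm (2 * u x - cis (magnetic_phase A x (x + z)) * u (x + z)
                   - cis (magnetic_phase A x (x - z)) * u (x - z)) \<le> C * norm z powr (1 + \<gamma>)"
    if x: "x \<in> cball 0 R" and z: "z \<in> cball 0 1" for x z
  proof -
    define a where "a = magnetic_phase A x (x + z)"
    define b where "b = magnetic_phase A x (x - z)"
    let ?p = "x + (1/2) *\<^sub>R z" and ?q = "x - (1/2) *\<^sub>R z"
    have pq: "(1/2) *\<^sub>R (x + (x + z)) = ?p" "(1/2) *\<^sub>R (x + (x - z)) = ?q"
      by (simp_all add: vec_eq_iff field_simps)
    have a: "a = - (z \<bullet> A ?p)" and b: "b = z \<bullet> A ?q"
      unfolding a_def b_def magnetic_phase_def pq by simp_all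
    have z1: "norm z \<le> 1" using z by simp
    have mem: "?p \<in> cball 0 (R+1)" "?q \<in> cball 0 (R+1)" "x + z \<in> cball 0 (R+1)" "x - z \<in> cball 0 (R+1)" "x \<in> cball 0 (R+1)"
      using x z1 norm_triangle_ineq[of x "(1/2) *\<^sub>R z"] norm_triangle_ineq4[of x "(1/2) *\<^sub>R z"]
        norm_triangle_ineq[of x z] norm_triangle_ineq4[of x z] by auto
    have ab: "\<bar>a\<bar> \<le> \<bar>MA\<bar> * norm z" "\<bar>b\<bar> \<le> \<bar>MA\<bar> * norm z"
      unfolding a b using MA[OF mem(1)] MA[OF mem(2)]
        Cauchy_Schwarz_ineq2[of z "A ?p"] Cauchy_Schwarz_ineq2[of z "A ?q"]
      by (auto simp: mult.commute[of "\<bar>MA\<bar>"] intro: order_trans[OF _ mult_left_mono])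
    have "\<bar>a + b\<bar> = \<bar>z \<bullet> (A ?q - A ?p)\<bar>" by (simp add: a b inner_diff_right)
    also have "\<dots> \<le> norm z * norm (A ?q - A ?p)" by (rule Cauchy_Schwarz_ineq2)
    also have "\<dots> \<le> norm z * (LA * norm (?q - ?p))"
      using LA(2)[OF mem(2,1)] by (intro mult_left_mono) auto
    also have "?q - ?p = - z" by (simp add: algebra_simps flip: scaleR_add_left)
    finally have "\<bar>a + b\<bar> \<le> LA * (norm z)\<^sup>2" by (simp add: power2_eq_square mult_ac)
    moreover have "(a\<^sup>2 + b\<^sup>2) / 2 \<le> (MA\<^sup>2 * (norm z)\<^sup>2 + MA\<^sup>2 * (norm z)\<^sup>2) / 2"
      using power_mono[OF ab(1), of 2] power_mono[OF ab(2), of 2]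
      by (intro divide_right_mono add_mono) (simp_all add: power_mult_distrib)
    ultimately have "cmod (cis a + cis b - 2) \<le> LA * (norm z)\<^sup>2 + (MA\<^sup>2 * (norm z)\<^sup>2 + MA\<^sup>2 * (norm z)\<^sup>2) / 2"
      by (intro order_trans[OF norm_cis_plus_cis_minus_2_le] add_mono)
    hence "cmod (cis a + cis b - 2) \<le> (LA + MA\<^sup>2) * (norm z)\<^sup>2"
      by (simp add: distrib_right)
    hence E1: "cmod ((cis a + cis b - 2) * u x) \<le> (LA + MA\<^sup>2) * (norm z)\<^sup>2 * \<bar>M\<bar>"
      unfolding norm_mult using M[OF x] LA(1) by (intro mult_mono) auto
    have E2: "cmod ((cis a - 1) * (u (x + z) - u x)) \<le> (2 * (\<bar>MA\<bar> * norm z)) * (L * norm z)"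
      unfolding norm_mult using L(2)[OF mem(3,5)] norm_cis_minus_1_le[of a] ab(1) L(1)
      by (intro mult_mono) auto
    have E3: "cmod ((cis b - 1) * (u (x - z) - u x)) \<le> (2 * (\<bar>MA\<bar> * norm z)) * (L * norm z)"
      unfolding norm_mult using L(2)[OF mem(4,5)] norm_cis_minus_1_le[of b] ab(2) L(1)
      by (intro mult_mono) auto
    have "2 * u x - cis a * u (x + z) - cis b * u (x - z)
        = (2 *\<^sub>R u x - u (x + z) - u (x - z)) - (cis a + cis b - 2) * u x
          - (cis a - 1) * (u (x + z) - u x) - (cis b - 1) * (u (x - z) - u x)"
      by (simp add: algebra_simps scaleR_conv_of_real)
    also have "norm \<dots> \<le> C0 * norm z powr (1 + \<gamma>) + (LA + MA\<^sup>2) * (norm z)\<^sup>2 * \<bar>M\<bar>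
        + (2 * (\<bar>MA\<bar> * norm z)) * (L * norm z) + (2 * (\<bar>MA\<bar> * norm z)) * (L * norm z)"
      by (intro norm_triangle_le_diff add_mono E1 E2 E3 C0(2) x z)
    also have "\<dots> = C0 * norm z powr (1 + \<gamma>) + ((LA + MA\<^sup>2) * \<bar>M\<bar> + 4 * \<bar>MA\<bar> * L) * (norm z)\<^sup>2"
      by (simp add: algebra_simps power2_eq_square)
    also have "\<dots> \<le> C0 * norm z powr (1 + \<gamma>) + ((LA + MA\<^sup>2) * \<bar>M\<bar> + 4 * \<bar>MA\<bar> * L) * norm z powr (1 + \<gamma>)"
    proof (intro add_left_mono mult_left_mono)
      show "(norm z)\<^sup>2 \<le> norm z powr (1 + \<gamma>)"
      proof (cases "z = 0")
        case False
        hence "norm z powr 2 \<le> norm z powr (1 + \<gamma>)" using z1 \<gamma> by (intro powr_mono') auto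
        thus ?thesis using False by simp
      qed simp
    qed (use LA L in simp)
    finally show ?thesis unfolding a_def b_def C_def by (simp add: algebra_simps)
  qed
  ultimately show ?thesis by blast
qed

section \<open>Smooth functions with compact support\<close>

lemma C_k_SucI:
  assumes "\<And>x. (g has_derivative D x) (at x)" "\<And>b. b \<in> Basis \<Longrightarrow> C_k k (\<lambda>x. D x b)"
  shows "C_k (Suc k) g"
proof -
  have "frechet_derivative g (at x) = D x" for x
    using frechet_derivative_at[OF assms(1)] by simp
  thus ?thesis using assms by (auto simp: differentiable_def)
qed

lemma C_k_SucE:
  assumes "C_k (Suc k) g"
  obtains D where "\<And>x. (g has_derivative D x) (at x)" "\<And>b. b \<in> Basis \<Longrightarrow> C_k k (\<lambda>x. D x b)"
  using assms that[of "\<lambda>x. frechet_derivative g (at x)"] by (auto simp: frechet_derivative_works)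

lemma C_k_const: "C_k k (\<lambda>x. c)"
proof (induction k arbitrary: c)
  case (Suc k)
  show ?case by (rule C_k_SucI[where D = "\<lambda>x h. 0"]) (use Suc in auto)
qed simp

lemma C_k_add: "C_k k f \<Longrightarrow> C_k k g \<Longrightarrow> C_k k (\<lambda>x. f x + g x)"
proof (induction k arbitrary: f g)
  case (Suc k)
  obtain F where F: "\<And>x. (f has_derivative F x) (at x)" "\<And>b. b \<in> Basis \<Longrightarrow> C_k k (\<lambda>x. F x b)"
    by (rule C_k_SucE[OF Suc.prems(1)]) (rule that)
  obtain G where G: "\<And>x. (g has_derivative G x) (at x)" "\<And>b. b \<in> Basis \<Longrightarrow> C_k k (\<lambda>x. G x b)"
    by (rule C_k_SucE[OF Suc.prems(2)]) (rule that)
  show ?case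
    by (rule C_k_SucI[OF has_derivative_add[OF F(1) G(1)]]) (intro Suc.IH F G)
qed (simp add: continuous_on_add)

lemma C_k_mult:
  fixes f g :: "'a::euclidean_space \<Rightarrow> 'b::real_normed_algebra"
  shows "C_k k f \<Longrightarrow> C_k k g \<Longrightarrow> C_k k (\<lambda>x. f x * g x)"
proof (induction k arbitrary: f g)
  case (Suc k)
  obtain F where F: "\<And>x. (f has_derivative F x) (at x)" "\<And>b. b \<in> Basis \<Longrightarrow> C_k k (\<lambda>x. F x b)"
    by (rule C_k_SucE[OF Suc.prems(1)]) (rule that)
  obtain G where G: "\<And>x. (g has_derivative G x) (at x)" "\<And>b. b \<in> Basis \<Longrightarrow> C_k k (\<lambda>x. G x b)"
    by (rule C_k_SucE[OF Suc.prems(2)]) (rule that)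
  show ?case
    by (rule C_k_SucI[OF has_derivative_mult[OF F(1) G(1)]])
       (intro C_k_add Suc.IH F G C_k_Suc_D[OF Suc.prems(1)] C_k_Suc_D[OF Suc.prems(2)])
qed (simp add: continuous_on_mult)

lemma C_k_prod:
  fixes f :: "'i \<Rightarrow> 'a::euclidean_space \<Rightarrow> 'b::{real_normed_algebra, comm_ring_1}"
  assumes "finite S" "\<And>i. i \<in> S \<Longrightarrow> C_k k (f i)"
  shows "C_k k (\<lambda>x. \<Prod>i\<in>S. f i x)"
  using assms by (induction S rule: finite_induct) (auto intro!: C_k_const C_k_mult)

text \<open>The classical functions that vanish to infinite order at \<open>0\<close>. The family over all \<open>n\<close> is
  closed under differentiation up to linear combinations, so that smoothness of \<open>flat 0\<close> follows by
  induction on the order, for all \<open>n\<close> at once.\<close>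

definition flat :: "nat \<Rightarrow> real \<Rightarrow> real" where
  "flat n t = (if 0 < t then inverse t ^ n * exp (- inverse t) else 0)"

lemma flat_tendsto_0_at_right: "(flat n \<longlongrightarrow> 0) (at_right 0)"
proof -
  have "((\<lambda>t::real. inverse t ^ n / exp (inverse t)) \<longlongrightarrow> 0) (at_right 0)"
    by (rule filterlim_compose[OF tendsto_power_div_exp_0 filterlim_inverse_at_top_right])
  thus ?thesis
    by (rule Lim_transform_eventually)
       (auto simp: flat_def exp_minus field_simps eventually_at_right_less intro!: eventually_mono[OF eventually_at_right_less])
qed

lemma flat_has_derivative:
  "(flat n has_real_derivative flat (n + 2) t - n * flat (n + 1) t) (at t)"
proof -
  consider "0 < t" | "t < 0" | "t = 0" by linarith
  thus ?thesis
  proof cases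
    case 1
    have "((\<lambda>t. inverse t ^ n * exp (- inverse t)) has_real_derivative
        flat (n + 2) t - n * flat (n + 1) t) (at t)"
      using 1 by (auto intro!: derivative_eq_intros simp: flat_def power2_eq_square)
         (cases n; auto simp: field_simps power2_eq_square)
    thus ?thesis
      by (rule has_field_derivative_transform_within_open[where S = "{0<..}"])
         (use 1 in \<open>auto simp: flat_def\<close>)
  next
    case 2
    have "((\<lambda>t. 0) has_real_derivative flat (n + 2) t - n * flat (n + 1) t) (at t)"
      using 2 by (simp add: flat_def)
    thus ?thesis
      by (rule has_field_derivative_transform_within_open[where S = "{..<0}"])
         (use 2 in \<open>auto simp: flat_def\<close>)
  next
    case 3
    have "((\<lambda>h. flat n h / h) \<longlongrightarrow> 0) (at_right 0)"
      by (rule Lim_transform_eventually[OF flat_tendsto_0_at_right[of "n + 1"]])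
         (auto simp: flat_def divide_inverse mult_ac intro!: eventually_mono[OF eventually_at_right_less])
    moreover have "((\<lambda>h. flat n h / h) \<longlongrightarrow> 0) (at_left 0)"
      by (rule Lim_transform_eventually[OF tendsto_const])
         (auto simp: flat_def eventually_at_filter)
    ultimately have "((\<lambda>h. flat n h / h) \<longlongrightarrow> 0) (at 0)" by (intro filterlim_split_at)
    thus ?thesis using 3 by (simp add: DERIV_def flat_def[of _ 0])
  qed
qed

lemma C_k_flat_affine:
  fixes w :: "'a::euclidean_space"
  shows "C_k k (\<lambda>x. complex_of_real (flat n (c + x \<bullet> w)))"
proof (induction k arbitrary: n)
  case 0
  have "isCont (flat n) t" for t using flat_has_derivative by (rule DERIV_isCont)
  hence "continuous_on UNIV (flat n)" by (simp add: continuous_at_imp_continuous_on)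
  thus ?case by (auto intro!: continuous_intros continuous_on_compose2[of UNIV "flat n"])
next
  case (Suc k)
  let ?D = "\<lambda>x h. complex_of_real (h \<bullet> w) * complex_of_real (flat (n + 2) (c + x \<bullet> w))
      + complex_of_real (- n * (h \<bullet> w)) * complex_of_real (flat (n + 1) (c + x \<bullet> w))"
  show ?case
  proof (rule C_k_SucI[where D = ?D])
    fix x
    have "((\<lambda>x. flat n (c + x \<bullet> w)) has_derivative
        (\<lambda>h. (flat (n + 2) (c + x \<bullet> w) - n * flat (n + 1) (c + x \<bullet> w)) * (h \<bullet> w))) (at x)"
      by (rule has_derivative_compose[where f = "\<lambda>x. c + x \<bullet> w", OF _
            flat_has_derivative[unfolded has_field_derivative_def]])
         (auto intro!: derivative_eq_intros)
    hence "((\<lambda>x. complex_of_real (flat n (c + x \<bullet> w))) has_derivative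
        (\<lambda>h. complex_of_real ((flat (n + 2) (c + x \<bullet> w) - n * flat (n + 1) (c + x \<bullet> w)) * (h \<bullet> w)))) (at x)"
      by (rule has_derivative_of_real)
    thus "((\<lambda>x. complex_of_real (flat n (c + x \<bullet> w))) has_derivative ?D x) (at x)"
      by (rule has_derivative_eq_rhs) (simp add: algebra_simps)
  next
    fix b :: 'a
    show "C_k k (\<lambda>x. ?D x b)" by (intro C_k_add C_k_mult C_k_const Suc)
  qed
qed

lemma flat_0_bounds: "0 \<le> flat 0 t" "flat 0 t \<le> 1" "t \<le> 0 \<Longrightarrow> flat 0 t = 0"
  by (auto simp: flat_def)

lemma flat_0_scaled_tendsto_1:
  assumes "0 < t"
  shows "(\<lambda>n. flat 0 (real (Suc n) * t)) \<longlonglongrightarrow> 1"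
proof -
  have "(\<lambda>n. exp (- (inverse (real (Suc n)) * inverse t))) \<longlonglongrightarrow> exp (- (0 * inverse t))"
    by (intro tendsto_intros LIMSEQ_inverse_real_of_nat)
  thus ?thesis using assms by (simp add: flat_def inverse_mult_distrib zero_less_mult_iff)
qed

text \<open>The factor \<open>flat 0 (n * t)\<close> vanishes for \<open>t \<le> 0\<close> and tends to \<open>1\<close> for \<open>t > 0\<close>. Applied to the signed distances
  from the faces of the box, the product of these factors approximates the indicator function from below.\<close>

lemma test_functions_approximate_box:
  fixes a b :: "'a::euclidean_space"
  shows "\<exists>\<phi>::nat \<Rightarrow> 'a \<Rightarrow> real. (\<forall>n. (\<lambda>x. complex_of_real (\<phi> n x)) \<in> test_functions) \<and>
    (\<forall>n x. 0 \<le> \<phi> n x \<and> \<phi> n x \<le> indicator (box a b) x) \<and>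
    (\<forall>x. (\<lambda>n. \<phi> n x) \<longlonglongrightarrow> indicator (box a b) x)"
proof -
  define \<psi> where "\<psi> n e x = flat 0 (real (Suc n) * (x \<bullet> e - a \<bullet> e)) * flat 0 (real (Suc n) * (b \<bullet> e - x \<bullet> e))"
    for n and e x :: 'a
  define \<phi> where "\<phi> n x = (\<Prod>e\<in>Basis. \<psi> n e x)" for n and x :: 'a
  have \<psi>: "0 \<le> \<psi> n e x" "\<psi> n e x \<le> 1" for n e x
    unfolding \<psi>_def by (auto intro!: mult_nonneg_nonneg mult_le_one simp: flat_0_bounds)
  have out: "\<phi> n x = 0" if x: "x \<notin> box a b" for n x
  proof -
    obtain e where e: "e \<in> Basis" "x \<bullet> e \<le> a \<bullet> e \<or> b \<bullet> e \<le> x \<bullet> e"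
      using x unfolding mem_box by (meson not_less)
    hence "\<psi> n e x = 0"
      by (auto simp: \<psi>_def mult_le_0_iff flat_0_bounds(3))
    thus ?thesis using e(1) by (auto simp: \<phi>_def)
  qed
  have test: "(\<lambda>x. complex_of_real (\<phi> n x)) \<in> test_functions" for n
  proof -
    have eq: "complex_of_real (\<phi> n x) = (\<Prod>e\<in>Basis.
        complex_of_real (flat 0 (- real (Suc n) * (a \<bullet> e) + x \<bullet> (real (Suc n) *\<^sub>R e))) *
        complex_of_real (flat 0 (real (Suc n) * (b \<bullet> e) + x \<bullet> (- real (Suc n) *\<^sub>R e))))" for x
      by (simp add: \<phi>_def \<psi>_def algebra_simps)
    have "C_k k (\<lambda>x. complex_of_real (\<phi> n x))" for k
      unfolding eq by (intro C_k_prod C_k_mult C_k_flat_affine) auto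
    moreover have "{x. complex_of_real (\<phi> n x) \<noteq> 0} \<subseteq> box a b" using out by auto
    hence "bounded {x. complex_of_real (\<phi> n x) \<noteq> 0}" by (rule bounded_subset[OF bounded_box])
    ultimately show ?thesis by (simp add: test_functions_def compact_closure)
  qed
  have "0 \<le> \<phi> n x \<and> \<phi> n x \<le> indicator (box a b) x" for n x
  proof (cases "x \<in> box a b")
    case True
    thus ?thesis using \<psi> by (auto simp: \<phi>_def intro!: prod_nonneg prod_le_1)
  qed (simp add: out)
  moreover have "(\<lambda>n. \<phi> n x) \<longlonglongrightarrow> indicator (box a b) x" for x
  proof (cases "x \<in> box a b")
    case True
    have "(\<lambda>n. \<phi> n x) \<longlonglongrightarrow> (\<Prod>e\<in>(Basis::'a set). 1 * 1)"
      unfolding \<phi>_def \<psi>_def using True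
      by (intro tendsto_intros flat_0_scaled_tendsto_1) (auto simp: mem_box)
    thus ?thesis using True by simp
  qed (simp add: out)
  ultimately show ?thesis using test by (intro exI[of _ \<phi>]) blast
qed

section \<open>The fundamental lemma of the calculus of variations\<close>

lemma sigma_finite_lebesgue: "sigma_finite_measure (lebesgue :: 'a::euclidean_space measure)"
proof
  obtain F :: "'a set set" where F: "countable F" "F \<subseteq> sets lborel" "\<Union>F = space lborel"
    "\<forall>a\<in>F. emeasure lborel a \<noteq> \<infinity>"
    using lborel.sigma_finite_countable by blast
  hence "\<forall>a\<in>F. emeasure lebesgue a \<noteq> \<infinity>" by (auto simp: emeasure_completion)
  thus "\<exists>F. countable F \<and> F \<subseteq> sets (lebesgue :: 'a measure) \<and> \<Union>F = space (lebesgue :: 'a measure)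
      \<and> (\<forall>a\<in>F. emeasure lebesgue a \<noteq> \<infinity>)"
    using F(1-3) by (intro exI[of _ F] conjI) auto
qed

text \<open>Boxes form an intersection-stable generator of the Borel sets, so the integral of \<open>g\<close> over every
  Borel subset of a large box vanishes; Lebesgue sets differ from Borel sets by null sets.\<close>

lemma AE_zero_if_box_integrals_zero:
  fixes g :: "'a::euclidean_space \<Rightarrow> complex"
  assumes loc: "locally_integrable g"
    and box: "\<And>a b. (LINT x:box a b|lebesgue. g x) = 0"
  shows "AE x in lebesgue. g x = 0"
proof -
  have "AE x in lebesgue. x \<in> box (- real N *\<^sub>R One) (real N *\<^sub>R One) \<longrightarrow> g x = 0" for N
  proof -
    let ?B = "box (- real N *\<^sub>R One) (real N *\<^sub>R One) :: 'a set"
    let ?g = "\<lambda>x. indicator ?B x *\<^sub>R g x"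
    have "set_integrable lebesgue (cbox (- real N *\<^sub>R One) (real N *\<^sub>R One)) g"
      using loc compact_cbox unfolding locally_integrable_def by blast
    hence "set_integrable lebesgue ?B g"
      by (rule set_integrable_subset) (auto simp: box_subset_cbox)
    hence int: "integrable lebesgue ?g" by (simp add: set_integrable_def)
    have stable: "Int_stable (range (\<lambda>(a, b). box a b :: 'a set))"
      by (auto simp: Int_stable_def box_Int_box)
    have subset_Pow: "range (\<lambda>(a, b). box a b :: 'a set) \<subseteq> Pow UNIV" by simp
    have sigma_box: "sigma_sets UNIV (range (\<lambda>(a, b). box a b :: 'a set)) = sets borel"
      by (subst borel_eq_box) simp
    have borel: "set_lebesgue_integral lebesgue S ?g = 0" if "S \<in> sets borel" for S
    proof -
      have "S \<in> sigma_sets UNIV (range (\<lambda>(a, b). box a b :: 'a set))"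
        using that unfolding sigma_box .
      thus ?thesis
      proof (induction rule: sigma_sets_induct_disjoint[OF stable subset_Pow, consumes 1, case_names basic empty compl union])
        case (basic A)
        then obtain a b where A: "A = box a b" by auto
        obtain c d where cd: "box a b \<inter> ?B = box c d" by (rule that, rule box_Int_box)
        have "set_lebesgue_integral lebesgue A ?g = (LINT x:box c d|lebesgue. g x)"
          unfolding set_lebesgue_integral_def cd[symmetric] A
          by (intro Bochner_Integration.integral_cong) (auto simp: indicator_def)
        thus ?case by (simp add: box)
      next
        case (compl A)
        have A: "A \<in> sets lebesgue" using compl(1) unfolding sigma_box by simp
        have "set_lebesgue_integral lebesgue (UNIV - A) ?g
            = (\<integral>x. ?g x - indicator A x *\<^sub>R ?g x \<partial>lebesgue)"
          unfolding set_lebesgue_integral_def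
          by (intro Bochner_Integration.integral_cong) (auto simp: indicator_def)
        also have "\<dots> = (\<integral>x. ?g x \<partial>lebesgue) - set_lebesgue_integral lebesgue A ?g"
          unfolding set_lebesgue_integral_def
          by (intro Bochner_Integration.integral_diff int integrable_mult_indicator A)
        also have "(\<integral>x. ?g x \<partial>lebesgue) = 0"
          using box unfolding set_lebesgue_integral_def by simp
        finally show ?case using compl(2) by simp
      next
        case (union A)
        have A: "A i \<in> sets lebesgue" for i
          using union(2) unfolding sigma_box by (auto simp: image_subset_iff)
        have "set_lebesgue_integral lebesgue (\<Union>i. A i) ?g
            = (\<Sum>i. set_lebesgue_integral lebesgue (A i) ?g)"
        proof (rule lebesgue_integral_countable_add[OF A])
          show "A i \<inter> A j = {}" if "i \<noteq> j" for i j
            using union(1) that by (simp add: disjoint_family_on_def)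
          show "set_integrable lebesgue (\<Union>i. A i) ?g"
            unfolding set_integrable_def by (intro integrable_mult_indicator int sets.countable_UN) (use A in auto)
        qed
        thus ?case using union(3) by simp
      qed (simp add: set_lebesgue_integral_def)
    qed
    have "AE x in lebesgue. ?g x = 0"
    proof (rule sigma_finite_measure.density_zero[OF sigma_finite_lebesgue int])
      fix A :: "'a set" assume A: "A \<in> sets lebesgue"
      then obtain S N N' where S: "A = S \<union> N" "N \<subseteq> N'" "N' \<in> null_sets lborel" "S \<in> sets lborel"
        by (rule sets_completionE)
      have "N' \<in> null_sets lebesgue" using S(3) by (rule null_sets_completionI)
      hence "(A - S) \<union> (S - A) \<in> null_sets lebesgue"
        by (rule null_sets_completion_subset[rotated]) (use S in auto)
      hence "set_lebesgue_integral lebesgue A ?g = set_lebesgue_integral lebesgue S ?g"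
        using S A by (intro set_integral_null_delta int) auto
      thus "set_lebesgue_integral lebesgue A ?g = 0" using borel S by simp
    qed
    thus ?thesis by eventually_elim auto
  qed
  hence "AE x in lebesgue. \<forall>N. x \<in> box (- real N *\<^sub>R One) (real N *\<^sub>R One) \<longrightarrow> g x = 0"
    unfolding AE_all_countable by blast
  thus ?thesis
  proof eventually_elim
    case (elim x)
    obtain N where "norm x < real N" using reals_Archimedean2 by blast
    hence "\<bar>x \<bullet> i\<bar> < real N" if "i \<in> Basis" for i using Basis_le_norm[OF that, of x] by linarith
    hence "x \<in> box (- real N *\<^sub>R One) (real N *\<^sub>R One)" by (force simp: mem_box abs_less_iff)
    thus ?case using elim by blast
  qed
qed

text \<open>Testing with \<open>\<phi>\<close> and with \<open>\<i> \<phi>\<close> recovers the complex integral from real parts. The test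
  functions that approximate a box from below then give, by dominated convergence, a vanishing integral
  over the box.\<close>

lemma fundamental_lemma:
  fixes g :: "'a::euclidean_space \<Rightarrow> complex"
  assumes loc: "locally_integrable g"
    and orth: "\<And>\<phi>. \<phi> \<in> test_functions \<Longrightarrow> Re (LINT x|lebesgue. g x * cnj (\<phi> x)) = 0"
  shows "AE x in lebesgue. g x = 0"
proof (rule AE_zero_if_box_integrals_zero[OF loc])
  fix a b :: 'a
  obtain \<phi> :: "nat \<Rightarrow> 'a \<Rightarrow> real" where test: "\<And>n. (\<lambda>x. complex_of_real (\<phi> n x)) \<in> test_functions"
    and \<phi>: "\<And>n x. 0 \<le> \<phi> n x" "\<And>n x. \<phi> n x \<le> indicator (box a b) x"
    and lim: "\<And>x. (\<lambda>n. \<phi> n x) \<longlonglongrightarrow> indicator (box a b) x"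
    using test_functions_approximate_box[of a b] by blast
  have [measurable]: "\<phi> n \<in> borel_measurable lebesgue" for n
  proof -
    have "C_k 0 (\<lambda>x. complex_of_real (\<phi> n x))" using test[of n] unfolding test_functions_def by blast
    hence "continuous_on UNIV (\<lambda>x. Re (complex_of_real (\<phi> n x)))" by (intro continuous_on_Re) simp
    hence "\<phi> n \<in> borel_measurable borel" by (simp add: borel_measurable_continuous_onI)
    thus ?thesis by (simp add: measurable_completion)
  qed
  let ?h = "\<lambda>x. indicator (box a b) x *\<^sub>R g x"
  have "set_integrable lebesgue (cbox a b) g"
    using loc compact_cbox unfolding locally_integrable_def by blast
  hence "set_integrable lebesgue (box a b) g"
    by (rule set_integrable_subset) (auto simp: box_subset_cbox)
  hence int: "integrable lebesgue ?h" by (simp add: set_integrable_def)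
  have eq: "\<phi> n x *\<^sub>R g x = \<phi> n x *\<^sub>R ?h x" for n x
    using \<phi>(1)[of n x] \<phi>(2)[of n x] by (cases "x \<in> box a b") auto
  have zero: "(\<integral>x. \<phi> n x *\<^sub>R g x \<partial>lebesgue) = 0" for n
  proof -
    let ?I = "\<integral>x. \<phi> n x *\<^sub>R g x \<partial>lebesgue"
    have "(LINT x|lebesgue. g x * cnj (complex_of_real (\<phi> n x))) = ?I"
      by (simp add: scaleR_conv_of_real mult.commute)
    hence Re: "Re ?I = 0" using orth[OF test[of n]] by simp
    have "(\<lambda>x. \<i> * complex_of_real (\<phi> n x)) \<in> test_functions"
    proof -
      have "C_k k (\<lambda>x. \<i> * complex_of_real (\<phi> n x))" for k
        using test[of n] by (intro C_k_mult C_k_const) (simp add: test_functions_def)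
      thus ?thesis using test[of n] by (simp add: test_functions_def)
    qed
    from orth[OF this] have "Re (LINT x|lebesgue. - \<i> * (\<phi> n x *\<^sub>R g x)) = 0"
      by (simp add: scaleR_conv_of_real mult_ac)
    hence "Im ?I = 0" by (subst (asm) integral_mult_right_zero) simp
    with Re show ?thesis by (simp add: complex_eq_iff)
  qed
  have "(\<lambda>n. \<integral>x. \<phi> n x *\<^sub>R ?h x \<partial>lebesgue) \<longlonglongrightarrow> (\<integral>x. indicator (box a b) x *\<^sub>R ?h x \<partial>lebesgue)"
  proof (rule integral_dominated_convergence[where w = "\<lambda>x. norm (?h x)"])
    show "AE x in lebesgue. norm (\<phi> n x *\<^sub>R ?h x) \<le> norm (?h x)" for n
      using \<phi>(1)[of n] \<phi>(2)[of n] order_trans[OF \<phi>(2)[of n] indicator_le_1]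
      by (intro AE_I2) (simp add: mult_left_le_one_le mult.assoc)
    show "(\<lambda>x. \<phi> n x *\<^sub>R ?h x) \<in> borel_measurable lebesgue" for n
      by (rule borel_measurable_scaleR[OF _ borel_measurable_integrable[OF int]]) measurable
    show "(\<lambda>x. indicator (box a b) x *\<^sub>R ?h x) \<in> borel_measurable lebesgue"
      by (rule borel_measurable_scaleR[OF _ borel_measurable_integrable[OF int]]) (intro borel_measurable_indicator, simp)
    show "integrable lebesgue (\<lambda>x. norm (?h x))" using int by (rule integrable_norm)
    show "AE x in lebesgue. (\<lambda>n. \<phi> n x *\<^sub>R ?h x) \<longlonglongrightarrow> indicator (box a b) x *\<^sub>R ?h x"
      by (intro AE_I2 tendsto_scaleR lim tendsto_const)
  qed
  hence "(\<integral>x. indicator (box a b) x *\<^sub>R ?h x \<partial>lebesgue) = 0"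
    unfolding eq[symmetric] zero by (rule LIMSEQ_unique) (rule tendsto_const)
  thus "(LINT x:box a b|lebesgue. g x) = 0"
    by (simp add: set_lebesgue_integral_def flip: indicator_inter_arith)
qed

section \<open>The quadratic form\<close>

lemma lborel_distr_reflect: "distr lborel borel (\<lambda>y. x - y) = (lborel :: 'a::euclidean_space measure)"
  using lborel_affine[of "-1" x] by (simp add: density_1)

lemma lborel_integrable_reflect:
  fixes F :: "'a::euclidean_space \<Rightarrow> 'b::{banach, second_countable_topology}"
  assumes "F \<in> borel_measurable borel"
  shows "integrable lborel (\<lambda>y. F (x - y)) \<longleftrightarrow> integrable lborel F"
  using integrable_distr_eq[of "\<lambda>y. x - y" lborel borel F] assms by (simp add: lborel_distr_reflect)

lemma lborel_integral_reflect:
  fixes F :: "'a::euclidean_space \<Rightarrow> 'b::{banach, second_countable_topology}"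
  assumes "F \<in> borel_measurable borel"
  shows "(\<integral>y. F (x - y) \<partial>lborel) = (\<integral>y. F y \<partial>lborel)"
  using integral_distr[of "\<lambda>y. x - y" lborel borel F] assms by (simp add: lborel_distr_reflect)

lemma integrable_product_difference:
  fixes a \<Phi> :: "'a::euclidean_space \<Rightarrow> real"
  assumes a: "integrable lborel a" and \<Phi>: "integrable lborel \<Phi>"
  shows "integrable (lborel \<Otimes>\<^sub>M lborel) (\<lambda>(x, y). a x * \<Phi> (x - y))"
proof -
  have [measurable]: "a \<in> borel_measurable borel" "\<Phi> \<in> borel_measurable borel" using assms by auto
  show ?thesis
  proof (rule lborel_pair.Fubini_integrable)
    have "(\<integral>y. norm (a x * \<Phi> (x - y)) \<partial>lborel) = norm (a x) * (\<integral>y. norm (\<Phi> y) \<partial>lborel)" for x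
      using lborel_integral_reflect[of "\<lambda>y. norm (\<Phi> y)" x] by (simp add: abs_mult)
    thus "integrable lborel (\<lambda>x. \<integral>y. norm (case (x, y) of (x, y) \<Rightarrow> a x * \<Phi> (x - y)) \<partial>lborel)"
      using a by simp
    show "AE x in lborel. integrable lborel (\<lambda>y. case (x, y) of (x, y) \<Rightarrow> a x * \<Phi> (x - y))"
      using \<Phi> by (simp add: lborel_integrable_reflect)
  qed measurable
qed

lemma borel_measurable_cis [measurable]: "cis \<in> borel_measurable borel"
  by (intro borel_measurable_continuous_onI continuous_intros)

lemma borel_measurable_cnj [measurable]: "cnj \<in> borel_measurable borel"
  by (intro borel_measurable_continuous_onI continuous_intros)

lemma magnetic_phase_swap: "magnetic_phase A y x = - magnetic_phase A x y"
  by (simp add: magnetic_phase_def add.commute flip: inner_minus_left)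

lemma kernel_commute: "kernel s m x y = kernel s m y x"
  by (simp add: kernel_def norm_minus_commute)

text \<open>Expanding the product and using that the phase is antisymmetric splits the form integrand into
  the operator integrand tested with \<open>v\<close> at \<open>x\<close> and the same expression with \<open>x\<close> and \<open>y\<close> exchanged. For
  bounded \<open>u\<close> and a test function \<open>v\<close> both parts are integrable away from the diagonal; near it, in
  general only their sum is.\<close>

lemma form_integrand_eq_operator_integrand:
  "form_integrand s m A u v (x, y) =
     operator_integrand s m A u x y * cnj (v x) + operator_integrand s m A u y x * cnj (v y)"
proof -
  define c where "c = cis (magnetic_phase A x y)"
  have c: "cis (magnetic_phase A y x) = cnj c" "cis (- magnetic_phase A x y) = cnj c" "cnj c * c = 1"
    by (simp_all add: c_def magnetic_phase_swap[of A y x] cis_cnj cis_mult)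
  have "form_integrand s m A u v (x, y)
      = ((cnj c * c) * u x * cnj (v x) - cnj c * u x * cnj (v y) - c * u y * cnj (v x) + u y * cnj (v y))
        * kernel s m x y"
    unfolding form_integrand_def using c(2) by (simp add: algebra_simps)
  thus ?thesis
    unfolding operator_integrand_def kernel_commute[of s m y x] c(1,3) c_def[symmetric]
    by (simp add: algebra_simps)
qed

lemma form_integrand_diagonal: "form_integrand s m A u v (x, x) = 0"
  by (simp add: form_integrand_def kernel_eq_radial_kernel)

lemma norm_form_integrand_self:
  "norm (form_integrand s m A u u (x, y))
     = (cmod (cis (- magnetic_phase A x y) * u x - u y))\<^sup>2 * kernel s m x y"
  by (simp add: form_integrand_def norm_mult power2_eq_square kernel_eq_radial_kernel radial_kernel_nonneg
      del: complex_cnj_diff complex_cnj_mult)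

text \<open>By \<open>2ab \<le> a\<^sup>2 + b\<^sup>2\<close>, the mixed form integrand of two functions of finite energy is integrable.\<close>

lemma norm_form_integrand_le:
  "norm (form_integrand s m A u v p) \<le> norm (form_integrand s m A u u p) + norm (form_integrand s m A v v p)"
proof -
  obtain x y where p: "p = (x, y)" by fastforce
  define a where "a = cmod (cis (- magnetic_phase A x y) * u x - u y)"
  define b where "b = cmod (cis (- magnetic_phase A x y) * v x - v y)"
  have "0 \<le> (a - b)\<^sup>2" by simp
  hence "2 * (a * b) \<le> a\<^sup>2 + b\<^sup>2" by (simp add: power2_diff)
  moreover have "0 \<le> a * b" by (simp add: a_def b_def)
  ultimately have "a * b \<le> a\<^sup>2 + b\<^sup>2" by linarith
  moreover have k: "0 \<le> kernel s m x y" by (simp add: kernel_eq_radial_kernel radial_kernel_nonneg)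
  ultimately have "a * b * kernel s m x y \<le> (a\<^sup>2 + b\<^sup>2) * kernel s m x y" by (rule mult_right_mono)
  moreover have "norm (form_integrand s m A u v p) = a * b * kernel s m x y"
    using k by (simp add: form_integrand_def p norm_mult a_def b_def del: complex_cnj_diff complex_cnj_mult)
  ultimately show ?thesis
    unfolding p norm_form_integrand_self by (simp add: distrib_right a_def b_def)
qed

lemma borel_measurable_operator_integrand:
  assumes [measurable]: "A \<in> borel_measurable borel" "u \<in> borel_measurable borel"
  shows "(\<lambda>p. operator_integrand s m A u (fst p) (snd p)) \<in> borel_measurable (borel \<Otimes>\<^sub>M borel)"
  unfolding operator_integrand_def magnetic_phase_def kernel_eq_radial_kernel
  by measurable

lemma borel_measurable_form_integrand:
  assumes [measurable]: "A \<in> borel_measurable borel" "u \<in> borel_measurable borel" "v \<in> borel_measurable borel"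
  shows "form_integrand s m A u v \<in> borel_measurable (borel \<Otimes>\<^sub>M borel)"
  unfolding form_integrand_def magnetic_phase_def kernel_eq_radial_kernel
  by measurable

lemma test_function_props:
  assumes "v \<in> test_functions"
  obtains R V where "0 \<le> R" "0 \<le> V" "\<And>x. x \<notin> cball 0 R \<Longrightarrow> v x = 0" "\<And>x. norm (v x) \<le> V"
    "continuous_on UNIV v" "C_k 1 v"
proof -
  have C: "C_k k v" for k using assms by (simp add: test_functions_def)
  have "compact (closure {x. v x \<noteq> 0})" using assms by (simp add: test_functions_def)
  from compact_imp_bounded[OF this] have "bounded {x. v x \<noteq> 0}"
    by (rule bounded_subset) (rule closure_subset)
  then obtain R where R: "\<And>x. v x \<noteq> 0 \<Longrightarrow> norm x \<le> R" by (auto simp: bounded_iff)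
  have cont: "continuous_on UNIV v" using C[of 0] by simp
  obtain V where V: "\<And>x. x \<in> cball 0 \<bar>R\<bar> \<Longrightarrow> norm (v x) \<le> V"
    using continuous_on_UNIV_bounded_on_cball[OF cont, of "\<bar>R\<bar>"] by blast
  have "norm (v x) \<le> \<bar>V\<bar>" for x
  proof (cases "v x = 0")
    case False
    hence "x \<in> cball 0 \<bar>R\<bar>" using R[of x] by simp
    from V[OF this] show ?thesis by simp
  qed simp
  moreover have "v x = 0" if "x \<notin> cball 0 \<bar>R\<bar>" for x
    using R[of x] that by (cases "v x = 0") auto
  ultimately show thesis by (intro that[of "\<bar>R\<bar>" "\<bar>V\<bar>"] C cont) auto
qed

lemma integrable_bounded_compact_support:
  fixes h :: "'a::euclidean_space \<Rightarrow> 'b::{banach, second_countable_topology}"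
  assumes "h \<in> borel_measurable borel" "\<And>x. x \<notin> cball 0 R \<Longrightarrow> h x = 0" "\<And>x. x \<in> cball 0 R \<Longrightarrow> norm (h x) \<le> V"
  shows "integrable lborel h"
proof (rule Bochner_Integration.integrable_bound)
  show "integrable lborel (\<lambda>x::'a. indicator (cball 0 R) x * \<bar>V\<bar>)"
    by (intro integrable_mult_left integrable_real_indicator)
       (use emeasure_bounded_finite[OF bounded_cball, of "0::'a" R] in auto)
  show "AE x in lborel. norm (h x) \<le> norm (indicator (cball 0 R) x * \<bar>V\<bar>)"
    using assms(2,3) by (intro AE_I2) (force simp: indicator_def)
qed (use assms(1) in simp)

text \<open>Let \<open>v\<close> be supported in the ball of radius \<open>R\<close>. For \<open>norm (x - y) \<le> 1\<close> the magnetic difference of \<open>v\<close> is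
  \<open>O(norm (x - y))\<close> and vanishes unless both points lie in the ball of radius \<open>R + 1\<close>; for distant points it is
  bounded and vanishes unless one point lies there. The square of the difference removes two powers from the
  singularity, which leaves \<open>norm (x - y) powr (- (1 + 2 * s))\<close>, integrable near the diagonal as \<open>s < 1\<close>.\<close>

lemma test_functions_finite_energy:
  assumes s: "0 < s" "s < 1" and m: "0 < m" and A: "continuous_on UNIV A" and v: "v \<in> test_functions"
  shows "v \<in> finite_energy s m A"
proof -
  obtain R V where R: "0 \<le> R" and V: "0 \<le> V" "\<And>x. norm (v x) \<le> V"
    and supp: "\<And>x. x \<notin> cball 0 R \<Longrightarrow> v x = 0" and cont: "continuous_on UNIV v" and C1: "C_k 1 v"
    using test_function_props[OF v] by metis
  have [measurable]: "v \<in> borel_measurable borel" "A \<in> borel_measurable borel"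
    using cont A by (auto intro: borel_measurable_continuous_onI)
  obtain L where L: "L \<ge> 0" "\<And>x y. x \<in> cball 0 (R+1) \<Longrightarrow> y \<in> cball 0 (R+1) \<Longrightarrow> norm (v x - v y) \<le> L * norm (x - y)"
    using C_1_Lipschitz_on_cball[OF C1, of "R+1"] by blast
  obtain MA where MA: "\<And>x. x \<in> cball 0 (R+1) \<Longrightarrow> norm (A x) \<le> MA"
    using continuous_on_UNIV_bounded_on_cball[OF A, of "R+1"] by blast
  obtain Ck where Ck: "Ck \<ge> 0" "\<And>z. radial_kernel s m z \<le> Ck * norm z powr (- (3 + 2 * s))"
    using radial_kernel_le[OF s(1) m] by blast
  let ?B = "cball 0 (R + 1) :: (real^3) set"
  define D where "D x y = cmod (cis (- magnetic_phase A x y) * v x - v y)" for x y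
  define c1 where "c1 = 2 * \<bar>MA\<bar> * V + L"
  define \<Phi> where "\<Phi> z = Ck * (c1\<^sup>2 * (indicator (cball 0 1) z * norm z powr (- (1 + 2 * s)))
      + (2 * V)\<^sup>2 * (indicator (- ball 0 1) z * norm z powr (- (3 + 2 * s))))" for z :: "real^3"
  have \<Phi>: "integrable lborel \<Phi>"
    unfolding \<Phi>_def using s
    by (intro integrable_mult_right Bochner_Integration.integrable_add
        integrable_norm_powr_near_0 integrable_norm_powr_at_infinity) auto
  have \<Phi>0: "0 \<le> \<Phi> z" for z using Ck by (simp add: \<Phi>_def)
  have indB: "integrable lborel (indicator ?B :: _ \<Rightarrow> real)"
    by (intro integrable_real_indicator)
       (use emeasure_bounded_finite[OF bounded_cball, of "0::real^3" "R + 1"] in auto)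
  have dom: "integrable (lborel \<Otimes>\<^sub>M lborel) (\<lambda>(x, y). indicator ?B x * \<Phi> (x - y))"
    by (rule integrable_product_difference[OF indB \<Phi>])
  have \<Phi>_even: "\<Phi> (y - x) = \<Phi> (x - y)" for x y
    unfolding \<Phi>_def by (simp add: norm_minus_commute indicator_def dist_norm)
  have dom': "integrable (lborel \<Otimes>\<^sub>M lborel) (\<lambda>(x, y). indicator ?B y * \<Phi> (x - y))"
    using lborel_pair.integrable_product_swap[OF dom] by (simp add: \<Phi>_even[symmetric])
  have bound: "D x y ^ 2 * radial_kernel s m (x - y) \<le> indicator ?B x * \<Phi> (x - y) + indicator ?B y * \<Phi> (x - y)" for x y
  proof (cases "x = y \<or> (x \<notin> cball 0 R \<and> y \<notin> cball 0 R)")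
    case True
    thus ?thesis using supp[of x] supp[of y] \<Phi>0 by (auto simp: D_def)
  next
    case False
    hence z: "norm (x - y) > 0" and xy: "x \<in> cball 0 R \<or> y \<in> cball 0 R" by auto
    have "D x y ^ 2 * radial_kernel s m (x - y) \<le> \<Phi> (x - y)"
    proof (cases "norm (x - y) \<le> 1")
      case True
      have "norm x \<le> R + 1" "norm y \<le> R + 1"
        using True xy norm_triangle_ineq2[of x y] norm_triangle_ineq2[of y x] by (auto simp: norm_minus_commute)
      moreover from this have "norm ((1/2) *\<^sub>R (x + y)) \<le> R + 1"
        using norm_triangle_ineq[of x y] by simp
      ultimately have B: "x \<in> ?B" "y \<in> ?B" "(1/2) *\<^sub>R (x + y) \<in> ?B" by auto
      have "\<bar>magnetic_phase A x y\<bar> \<le> norm (x - y) * norm (A ((1/2) *\<^sub>R (x + y)))"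
        unfolding magnetic_phase_def by (rule Cauchy_Schwarz_ineq2)
      also have "\<dots> \<le> norm (x - y) * \<bar>MA\<bar>"
        using MA[OF B(3)] by (intro mult_left_mono) auto
      finally have th: "\<bar>magnetic_phase A x y\<bar> \<le> norm (x - y) * \<bar>MA\<bar>" .
      have "D x y = cmod ((cis (- magnetic_phase A x y) - 1) * v x + (v x - v y))"
        unfolding D_def by (simp add: algebra_simps)
      also have "\<dots> \<le> cmod (cis (- magnetic_phase A x y) - 1) * cmod (v x) + cmod (v x - v y)"
        by (rule order_trans[OF norm_triangle_ineq]) (simp add: norm_mult)
      also have "\<dots> \<le> (2 * (norm (x - y) * \<bar>MA\<bar>)) * V + L * norm (x - y)"
        using norm_cis_minus_1_le[of "- magnetic_phase A x y"] th V(2)[of x] L(2)[OF B(1,2)]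
        by (intro add_mono mult_mono) auto
      also have "\<dots> = c1 * norm (x - y)" by (simp add: c1_def algebra_simps)
      finally have "D x y ^ 2 \<le> (c1 * norm (x - y)) ^ 2" by (intro power_mono) (auto simp: D_def)
      hence "D x y ^ 2 * radial_kernel s m (x - y)
          \<le> (c1 * norm (x - y)) ^ 2 * (Ck * norm (x - y) powr (- (3 + 2 * s)))"
        using Ck by (intro mult_mono radial_kernel_nonneg) auto
      also have "\<dots> = Ck * (c1\<^sup>2 * (norm (x - y) powr 2 * norm (x - y) powr (- (3 + 2 * s))))"
        using z by (simp add: power_mult_distrib)
      also have "norm (x - y) powr 2 * norm (x - y) powr (- (3 + 2 * s)) = norm (x - y) powr (- (1 + 2 * s))"
        by (subst powr_add[symmetric]) simp
      also have "Ck * (c1\<^sup>2 * norm (x - y) powr (- (1 + 2 * s))) \<le> \<Phi> (x - y)"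
      proof -
          have "x - y \<in> cball 0 1" using True by simp
          thus ?thesis unfolding \<Phi>_def using Ck(1) by (intro mult_left_mono) simp_all
        qed
      finally show ?thesis .
    next
      case False
      have "D x y \<le> cmod (v x) + cmod (v y)"
        unfolding D_def by (rule order_trans[OF norm_triangle_ineq4]) (simp add: norm_mult)
      hence "D x y \<le> 2 * V" using V(2)[of x] V(2)[of y] by linarith
      hence "D x y ^ 2 \<le> (2 * V) ^ 2" by (intro power_mono) (auto simp: D_def)
      hence "D x y ^ 2 * radial_kernel s m (x - y)
          \<le> (2 * V) ^ 2 * (Ck * norm (x - y) powr (- (3 + 2 * s)))"
        using Ck by (intro mult_mono radial_kernel_nonneg) auto
      also have "\<dots> \<le> \<Phi> (x - y)"
      proof -
        have "x - y \<in> - ball 0 1" "x - y \<notin> cball 0 1" using False by simp_all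
        thus ?thesis unfolding \<Phi>_def by simp
      qed
      finally show ?thesis .
    qed
    moreover have "x \<in> ?B \<or> y \<in> ?B" using xy by auto
    ultimately show ?thesis using \<Phi>0[of "x - y"] by (auto simp: indicator_def)
  qed
  have "integrable (lborel \<Otimes>\<^sub>M lborel) (form_integrand s m A v v)"
  proof (rule Bochner_Integration.integrable_bound[OF Bochner_Integration.integrable_add[OF dom dom']])
    show "form_integrand s m A v v \<in> borel_measurable (lborel \<Otimes>\<^sub>M lborel)"
      using borel_measurable_form_integrand[of A v v s m] by (simp cong: measurable_cong_sets)
    show "AE p in lborel \<Otimes>\<^sub>M lborel. norm (form_integrand s m A v v p) \<le> norm
        ((case p of (x, y) \<Rightarrow> indicator ?B x * \<Phi> (x - y)) + (case p of (x, y) \<Rightarrow> indicator ?B y * \<Phi> (x - y)))"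
    proof (intro AE_I2)
      fix p :: "(real^3) \<times> (real^3)"
      obtain x y where p: "p = (x, y)" by fastforce
      have "norm (form_integrand s m A v v (x, y)) = D x y ^ 2 * radial_kernel s m (x - y)"
        by (simp add: norm_form_integrand_self D_def kernel_eq_radial_kernel)
      thus "norm (form_integrand s m A v v p) \<le> norm
        ((case p of (x, y) \<Rightarrow> indicator ?B x * \<Phi> (x - y)) + (case p of (x, y) \<Rightarrow> indicator ?B y * \<Phi> (x - y)))"
        unfolding p using order_trans[OF bound abs_ge_self] by simp
    qed
  qed
  hence "integrable lborel (form_integrand s m A v v)" by (simp add: lborel_prod)
  hence "integrable lebesgue (form_integrand s m A v v)"
    by (subst integrable_completion) auto
  moreover have "integrable lborel (\<lambda>x. v x * cnj (v x))"
  proof (rule integrable_bounded_compact_support[of _ R "V * V"])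
    show "norm (v x * cnj (v x)) \<le> V * V" for x
      using V by (auto simp: norm_mult intro!: mult_mono)
  qed (use supp in auto)
  hence "integrable lebesgue (\<lambda>x. v x * cnj (v x))"
    by (subst integrable_completion) auto
  moreover have "v \<in> borel_measurable lebesgue" by (simp add: measurable_completion)
  ultimately show ?thesis by (simp add: finite_energy_def)
qed

lemma test_functions_subset_H_space:
  assumes "0 < s" "s < 1" "0 < m" "continuous_on UNIV A"
  shows "test_functions \<subseteq> H_space s m A"
proof
  fix v :: "real^3 \<Rightarrow> complex" assume v: "v \<in> test_functions"
  have fe: "v \<in> finite_energy s m A" using test_functions_finite_energy assms v by blast
  have "form_integrand s m A (\<lambda>x. 0) (\<lambda>x. 0) = (\<lambda>p. 0)"
    by (auto simp: form_integrand_def)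
  hence "norm_As s m A (\<lambda>x. v x - v x) = 0"
    by (simp add: norm_As_def inner_As_def seminorm_form_def L2_pairing_def)
  thus "v \<in> H_space s m A" using v fe unfolding H_space_def by force
qed

section \<open>The pointwise operator as an absolutely convergent integral\<close>

definition symmetric_difference ::
  "(real^3 \<Rightarrow> real^3) \<Rightarrow> (real^3 \<Rightarrow> complex) \<Rightarrow> real^3 \<Rightarrow> real^3 \<Rightarrow> complex" where
  "symmetric_difference A u x z = 2 * u x - cis (magnetic_phase A x (x + z)) * u (x + z)
      - cis (magnetic_phase A x (x - z)) * u (x - z)"

text \<open>The value of the principal value integral: averaging the integrand over \<open>y = x + z\<close> and \<open>y = x - z\<close>
  produces the symmetric difference, against which the kernel is integrable.\<close>

definition singular_integral ::
  "real \<Rightarrow> real \<Rightarrow> (real^3 \<Rightarrow> real^3) \<Rightarrow> (real^3 \<Rightarrow> complex) \<Rightarrow> real^3 \<Rightarrow> complex" where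
  "singular_integral s m A u x =
     (\<integral>z. radial_kernel s m z *\<^sub>R symmetric_difference A u x z \<partial>lborel) / 2"

lemma operator_integrand_symmetric_sum:
  "operator_integrand s m A u x (x + z) + operator_integrand s m A u x (x - z)
     = radial_kernel s m z *\<^sub>R symmetric_difference A u x z"
proof -
  have "kernel s m x (x + z) = radial_kernel s m z" "kernel s m x (x - z) = radial_kernel s m z"
    unfolding kernel_eq_radial_kernel by (simp_all add: radial_kernel_minus)
  thus ?thesis
    by (simp add: operator_integrand_def symmetric_difference_def scaleR_conv_of_real algebra_simps)
qed

text \<open>The properties of \<open>A\<close> and \<open>u\<close> under which the operator can be evaluated at every point. The bound of
  \<open>u\<close> is assumed at every point because an essential bound of a continuous function holds everywhere.\<close>

locale regular_bounded_function =
  fixes s m M \<gamma> :: real and A :: "real^3 \<Rightarrow> real^3" and u :: "real^3 \<Rightarrow> complex"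
  assumes s: "0 < s" "s < 1" and m: "0 < m"
    and A: "C_k 1 A"
    and u: "C1_loc_holder \<gamma> u" and bound: "\<And>x. norm (u x) \<le> M"
    and \<gamma>: "0 < \<gamma>" "\<gamma> \<le> 1" "2 * s - 1 < \<gamma>"
begin

lemma continuous_u: "continuous_on UNIV u" and continuous_A: "continuous_on UNIV A"
  using u C_k_imp_continuous_on[of 1] A by (auto simp: C1_loc_holder_def simp del: C_k.simps)

lemma measurable_u [measurable]: "u \<in> borel_measurable borel"
  and measurable_A [measurable]: "A \<in> borel_measurable borel"
  using continuous_u continuous_A by (auto intro: borel_measurable_continuous_onI)

lemma measurable_operator_integrand [measurable]:
  "(\<lambda>p. operator_integrand s m A u (fst p) (snd p)) \<in> borel_measurable (borel \<Otimes>\<^sub>M borel)"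
  by (rule borel_measurable_operator_integrand) measurable

lemma measurable_operator_integrand_snd [measurable]:
  "(\<lambda>y. operator_integrand s m A u x y) \<in> borel_measurable borel"
  unfolding operator_integrand_def magnetic_phase_def kernel_eq_radial_kernel
  by measurable

lemma M_nonneg: "0 \<le> M" using bound[of 0] norm_ge_zero order_trans by blast

text \<open>The exponent \<open>3 + 2 * s\<close> exceeds the dimension.\<close>

lemma integrable_kernel_tail:
  assumes "0 < e"
  shows "integrable lborel (\<lambda>z. indicator (- ball 0 e) z * radial_kernel s m z)"
proof -
  obtain C where C: "C \<ge> 0" "\<And>z. radial_kernel s m z \<le> C * norm z powr (- (3 + 2 * s))"
    using radial_kernel_le[OF s(1) m] by blast
  have "integrable lborel (\<lambda>z::real^3. C * (indicator (- ball 0 e) z * norm z powr (- (3 + 2 * s))))"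
    using s assms by (intro integrable_mult_right integrable_norm_powr_at_infinity) auto
  thus ?thesis
  proof (rule Bochner_Integration.integrable_bound)
    show "AE z in lborel. norm (indicator (- ball 0 e) z * radial_kernel s m z)
        \<le> norm (C * (indicator (- ball 0 e) z * norm z powr (- (3 + 2 * s))))"
      using C radial_kernel_nonneg by (intro AE_I2) (simp add: indicator_def abs_mult)
  qed measurable
qed

lemma norm_operator_integrand_le: "norm (operator_integrand s m A u x y) \<le> 2 * M * radial_kernel s m (x - y)"
proof -
  have "norm (u x - cis (magnetic_phase A x y) * u y) \<le> norm (u x) + norm (u y)"
    by (rule order_trans[OF norm_triangle_ineq4]) (simp add: norm_mult)
  also have "\<dots> \<le> 2 * M" using bound[of x] bound[of y] by simp
  finally show ?thesis
    by (simp add: operator_integrand_def norm_mult kernel_eq_radial_kernel radial_kernel_nonneg mult_right_mono)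
qed

lemma integrable_truncated_operator:
  assumes "0 < e"
  shows "integrable lborel (\<lambda>y. indicator (- ball 0 e) (x - y) *\<^sub>R operator_integrand s m A u x y)"
proof (rule Bochner_Integration.integrable_bound)
  show "integrable lborel (\<lambda>y. 2 * M * (indicator (- ball 0 e) (x - y) * radial_kernel s m (x - y)))"
    using integrable_kernel_tail[OF assms]
    by (intro integrable_mult_right) (simp add: lborel_integrable_reflect[of "\<lambda>z. indicator (- ball 0 e) z * radial_kernel s m z"])
  show "AE y in lborel. norm (indicator (- ball 0 e) (x - y) *\<^sub>R operator_integrand s m A u x y)
      \<le> norm (2 * M * (indicator (- ball 0 e) (x - y) * radial_kernel s m (x - y)))"
    using norm_operator_integrand_le M_nonneg radial_kernel_nonneg
    by (intro AE_I2) (simp add: indicator_def abs_mult)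
qed measurable

lemma indicator_ball_translate: "indicator (- ball x e) y = indicator (- ball 0 e) (x - y)"
  for x y :: "real^3"
  by (simp add: indicator_def dist_norm norm_minus_commute)

lemma set_integrable_operator_integrand:
  assumes "0 < e"
  shows "set_integrable lebesgue (- ball x e) (operator_integrand s m A u x)"
proof -
  have "integrable lebesgue (\<lambda>y. indicator (- ball 0 e) (x - y) *\<^sub>R operator_integrand s m A u x y)"
    by (subst integrable_completion) (use integrable_truncated_operator[OF assms] in auto)
  thus ?thesis by (simp add: set_integrable_def indicator_ball_translate[of x])
qed

lemma truncated_integral_lborel:
  "truncated_integral s m A u x e
     = (\<integral>y. indicator (- ball 0 e) (x - y) *\<^sub>R operator_integrand s m A u x y \<partial>lborel)"
  unfolding truncated_integral_def set_lebesgue_integral_def indicator_ball_translate[of x]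
  by (subst integral_completion) measurable

text \<open>The truncated domain is symmetric about \<open>x\<close>, so the integral may be written in \<open>z = x - y\<close> and in \<open>z = y - x\<close>;
  the mean of the two is the symmetric form.\<close>

lemma truncated_integral_symmetric:
  assumes "0 < e"
  shows "truncated_integral s m A u x e
     = (\<integral>z. indicator (- ball 0 e) z *\<^sub>R (radial_kernel s m z *\<^sub>R symmetric_difference A u x z) \<partial>lborel) / 2"
proof -
  let ?F = "\<lambda>z. indicator (- ball 0 e) z *\<^sub>R operator_integrand s m A u x (x - z)"
  let ?H = "\<lambda>z. indicator (- ball 0 e) z *\<^sub>R operator_integrand s m A u x (x + z)"
  have mF [measurable]: "?F \<in> borel_measurable borel" and mH [measurable]: "?H \<in> borel_measurable borel"
    by measurable
  have intF: "integrable lborel ?F"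
    using integrable_truncated_operator[OF assms, of x] lborel_integrable_reflect[OF mF, of x] by simp
  have FH: "?H = (\<lambda>z. ?F (0 - z))" by (auto simp: indicator_def fun_eq_iff)
  have intH: "integrable lborel ?H"
    unfolding FH using intF lborel_integrable_reflect[OF mF, of 0] by simp
  have T: "truncated_integral s m A u x e = (\<integral>z. ?F z \<partial>lborel)"
    unfolding truncated_integral_lborel using lborel_integral_reflect[OF mF, of x] by simp
  have T': "truncated_integral s m A u x e = (\<integral>z. ?H z \<partial>lborel)"
    unfolding T FH by (rule lborel_integral_reflect[OF mF, of 0, symmetric])
  have "2 * truncated_integral s m A u x e = (\<integral>z. ?H z \<partial>lborel) + (\<integral>z. ?F z \<partial>lborel)"
    using T T' by simp
  also have "\<dots> = (\<integral>z. ?H z + ?F z \<partial>lborel)"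
    by (rule Bochner_Integration.integral_add[OF intH intF, symmetric])
  also have "\<dots> = (\<integral>z. indicator (- ball 0 e) z *\<^sub>R (radial_kernel s m z *\<^sub>R symmetric_difference A u x z) \<partial>lborel)"
    unfolding operator_integrand_symmetric_sum[symmetric] scaleR_add_right ..
  finally show ?thesis by (simp add: eq_divide_eq mult.commute)
qed

lemma measurable_symmetric_difference [measurable]:
  "(\<lambda>p. radial_kernel s m (snd p) *\<^sub>R symmetric_difference A u (fst p) (snd p)) \<in> borel_measurable (borel \<Otimes>\<^sub>M borel)"
  unfolding symmetric_difference_def magnetic_phase_def by measurable

lemma measurable_symmetric_difference_snd [measurable]:
  "(\<lambda>z. radial_kernel s m z *\<^sub>R symmetric_difference A u x z) \<in> borel_measurable borel"
  unfolding symmetric_difference_def magnetic_phase_def by measurable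

text \<open>Near \<open>0\<close> the product of kernel and symmetric difference is bounded by a multiple of
  \<open>norm z powr (1 + \<gamma> - (3 + 2 * s))\<close>, which is integrable exactly because \<open>\<gamma> > 2 * s - 1\<close>. Away from \<open>0\<close> boundedness of \<open>u\<close>
  suffices. The majorant is uniform for \<open>x\<close> in a ball: this gives the limit at each point and also
  the locally uniform bound under which the limit commutes with integration against a test function.\<close>

lemma symmetric_difference_dominated:
  "\<exists>W. integrable lborel W \<and> (\<forall>x\<in>cball 0 R. \<forall>z.
     norm (radial_kernel s m z *\<^sub>R symmetric_difference A u x z) \<le> W z)"
proof -
  obtain Ck where Ck: "Ck \<ge> 0" "\<And>z. radial_kernel s m z \<le> Ck * norm z powr (- (3 + 2 * s))"
    using radial_kernel_le[OF s(1) m] by blast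
  obtain C where C: "C \<ge> 0" "\<And>x z. x \<in> cball 0 R \<Longrightarrow> z \<in> cball 0 1 \<Longrightarrow>
      norm (symmetric_difference A u x z) \<le> C * norm z powr (1 + \<gamma>)"
    using magnetic_second_difference[OF A u \<gamma>(1,2), of R] unfolding symmetric_difference_def by blast
  define W where "W z = Ck * (C * (indicator (cball 0 1) z * norm z powr (- (2 + 2 * s - \<gamma>)))
      + 4 * M * (indicator (- ball 0 1) z * norm z powr (- (3 + 2 * s))))" for z :: "real^3"
  have "integrable lborel W"
    unfolding W_def using s \<gamma>
    by (intro integrable_mult_right Bochner_Integration.integrable_add
        integrable_norm_powr_near_0 integrable_norm_powr_at_infinity) auto
  moreover have "norm (radial_kernel s m z *\<^sub>R symmetric_difference A u x z) \<le> W z"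
    if x: "x \<in> cball 0 R" for x z
  proof (cases "z \<in> cball 0 1")
    case True
    have "norm (radial_kernel s m z *\<^sub>R symmetric_difference A u x z)
        = radial_kernel s m z * norm (symmetric_difference A u x z)"
      by (simp add: radial_kernel_nonneg)
    also have "\<dots> \<le> (Ck * norm z powr (- (3 + 2 * s))) * (C * norm z powr (1 + \<gamma>))"
      using Ck by (intro mult_mono C(2) x True) auto
    also have "\<dots> = Ck * (C * (norm z powr (- (3 + 2 * s)) * norm z powr (1 + \<gamma>)))" by (simp add: mult_ac)
    also have "norm z powr (- (3 + 2 * s)) * norm z powr (1 + \<gamma>) = norm z powr (- (2 + 2 * s - \<gamma>))"
      by (subst powr_add[symmetric]) (simp add: algebra_simps)
    also have "Ck * (C * norm z powr (- (2 + 2 * s - \<gamma>))) \<le> W z"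
      unfolding W_def using True Ck(1) M_nonneg by (intro mult_left_mono) simp_all
    finally show ?thesis .
  next
    case False
    have tri: "norm (2 * a - b - c) \<le> 2 * norm a + norm b + norm c" for a b c :: complex
      using norm_triangle_ineq4[of "2 * a - b" c] norm_triangle_ineq4[of "2 * a" b] by (simp add: norm_mult)
    have "norm (symmetric_difference A u x z) \<le> 2 * norm (u x) + norm (u (x + z)) + norm (u (x - z))"
      unfolding symmetric_difference_def by (rule order_trans[OF tri]) (simp add: norm_mult)
    also have "\<dots> \<le> 4 * M" using bound[of x] bound[of "x + z"] bound[of "x - z"] by simp
    finally have S: "norm (symmetric_difference A u x z) \<le> 4 * M" .
    have "norm (radial_kernel s m z *\<^sub>R symmetric_difference A u x z)
        = radial_kernel s m z * norm (symmetric_difference A u x z)"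
      by (simp add: radial_kernel_nonneg)
    also have "\<dots> \<le> (Ck * norm z powr (- (3 + 2 * s))) * (4 * M)"
      using Ck by (intro mult_mono S) auto
    also have "\<dots> = W z" unfolding W_def using False by simp
    finally show ?thesis .
  qed
  ultimately show ?thesis by blast
qed

lemma truncated_integral_sequence:
  assumes pos: "\<And>n. 0 < e n" and lim: "e \<longlonglongrightarrow> 0"
  shows "(\<lambda>n. truncated_integral s m A u x (e n)) \<longlonglongrightarrow> singular_integral s m A u x"
proof -
  let ?f = "\<lambda>z. radial_kernel s m z *\<^sub>R symmetric_difference A u x z"
  obtain W where W: "integrable lborel W" "\<And>y z. y \<in> cball 0 (norm x) \<Longrightarrow>
      norm (radial_kernel s m z *\<^sub>R symmetric_difference A u y z) \<le> W z"
    using symmetric_difference_dominated[of "norm x"] by blast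
  have "(\<lambda>n. \<integral>z. indicator (- ball 0 (e n)) z *\<^sub>R ?f z \<partial>lborel) \<longlonglongrightarrow> (\<integral>z. ?f z \<partial>lborel)"
  proof (rule integral_dominated_convergence[where w = W])
    show "AE z in lborel. (\<lambda>n. indicator (- ball 0 (e n)) z *\<^sub>R ?f z) \<longlonglongrightarrow> ?f z"
    proof (rule AE_I2)
      fix z :: "real^3"
      \<comment> \<open>At \<open>z = 0\<close>, which every truncation removes, the kernel has the value \<open>0\<close>.\<close>
      show "(\<lambda>n. indicator (- ball 0 (e n)) z *\<^sub>R ?f z) \<longlonglongrightarrow> ?f z"
      proof (cases "z = 0")
        case False
        have "\<forall>\<^sub>F n in sequentially. e n < norm z"
          using lim False by (intro order_tendstoD) auto
        hence "\<forall>\<^sub>F n in sequentially. ?f z = indicator (- ball 0 (e n)) z *\<^sub>R ?f z"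
          by eventually_elim simp
        thus ?thesis by (rule Lim_transform_eventually[OF tendsto_const])
      qed simp
    qed
    show "AE z in lborel. norm (indicator (- ball 0 (e n)) z *\<^sub>R ?f z) \<le> W z" for n
    proof (rule AE_I2)
      fix z
      have "norm (?f z) \<le> W z" by (rule W(2)) simp
      moreover from this have "0 \<le> W z" by (rule order_trans[OF norm_ge_zero])
      ultimately show "norm (indicator (- ball 0 (e n)) z *\<^sub>R ?f z) \<le> W z" by (simp add: indicator_def)
    qed
  qed (use W(1) in measurable)
  thus ?thesis
    unfolding truncated_integral_symmetric[OF pos] singular_integral_def by (intro tendsto_divide tendsto_const) auto
qed

lemma truncated_integral_tendsto:
  "(truncated_integral s m A u x \<longlongrightarrow> singular_integral s m A u x) (at_right 0)"
  by (rule tendsto_at_right_sequentially[of _ 1]) (auto intro!: truncated_integral_sequence)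

lemma measurable_singular_integral [measurable]: "singular_integral s m A u \<in> borel_measurable borel"
proof -
  have "(\<lambda>x. \<integral>z. radial_kernel s m z *\<^sub>R symmetric_difference A u x z \<partial>lborel) \<in> borel_measurable borel"
    by (rule lborel.borel_measurable_lebesgue_integral)
       (use measurable_symmetric_difference in \<open>simp add: case_prod_beta' cong: measurable_cong_sets\<close>)
  thus ?thesis unfolding singular_integral_def[abs_def] by measurable
qed

lemma truncated_integral_bounded:
  "\<exists>B. \<forall>x\<in>cball 0 R. norm (singular_integral s m A u x) \<le> B
     \<and> (\<forall>e>0. norm (truncated_integral s m A u x e) \<le> B)"
proof -
  obtain W where W: "integrable lborel W" "\<And>x z. x \<in> cball 0 R \<Longrightarrow>
      norm (radial_kernel s m z *\<^sub>R symmetric_difference A u x z) \<le> W z"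
    using symmetric_difference_dominated[of R] by blast
  let ?B = "(\<integral>z. W z \<partial>lborel) / 2"
  have T: "norm (truncated_integral s m A u x e) \<le> ?B" if x: "x \<in> cball 0 R" and e: "0 < e" for x e
  proof -
    have "norm (\<integral>z. indicator (- ball 0 e) z *\<^sub>R (radial_kernel s m z *\<^sub>R symmetric_difference A u x z) \<partial>lborel)
        \<le> (\<integral>z. W z \<partial>lborel)"
    proof (rule Bochner_Integration.integral_norm_bound_integral)
      show *: "norm (indicator (- ball 0 e) z *\<^sub>R (radial_kernel s m z *\<^sub>R symmetric_difference A u x z)) \<le> W z" for z
        using W(2)[OF x, of z] order_trans[OF norm_ge_zero W(2)[OF x, of z]] by (simp add: indicator_def)
      show "integrable lborel (\<lambda>z. indicator (- ball 0 e) z *\<^sub>R (radial_kernel s m z *\<^sub>R symmetric_difference A u x z))"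
      proof (rule Bochner_Integration.integrable_bound[OF W(1)])
        show "AE z in lborel. norm (indicator (- ball 0 e) z *\<^sub>R (radial_kernel s m z *\<^sub>R symmetric_difference A u x z)) \<le> norm (W z)"
          using order_trans[OF * abs_ge_self] by (intro AE_I2) simp
      qed measurable
    qed (rule W(1))
    thus ?thesis unfolding truncated_integral_symmetric[OF e] by (simp add: norm_divide)
  qed
  moreover have "norm (singular_integral s m A u x) \<le> ?B" if "x \<in> cball 0 R" for x
  proof (rule Lim_norm_ubound[OF _ truncated_integral_tendsto])
    show "\<forall>\<^sub>F e in at_right 0. norm (truncated_integral s m A u x e) \<le> ?B"
      using T[OF that] by (auto simp: eventually_at_right_field intro!: exI[of _ 1])
  qed simp
  ultimately show ?thesis by blast
qed

section \<open>From the weak to the pointwise equation\<close>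

text \<open>Integration by parts for the nonlocal form. On \<open>norm (x - y) \<ge> e\<close> the two halves of the form integrand are
  separately integrable and exchanged by swapping the variables, so by Fubini the truncated form equals
  twice the truncated operator paired with \<open>v\<close>. As \<open>e\<close> tends to \<open>0\<close>, the left side converges because the form
  integrand is integrable, the right side because the truncated integrals converge pointwise and are bounded on the support of \<open>v\<close>.\<close>

lemma seminorm_form_test_function:
  assumes fe: "u \<in> finite_energy s m A" and v: "v \<in> test_functions"
  shows "seminorm_form s m A u v = 2 * Re (\<integral>x. singular_integral s m A u x * cnj (v x) \<partial>lborel)"
proof -
  obtain R V where R: "0 \<le> R" and V: "0 \<le> V" "\<And>x. norm (v x) \<le> V"
    and supp: "\<And>x. x \<notin> cball 0 R \<Longrightarrow> v x = 0" and cont: "continuous_on UNIV v"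
    using test_function_props[OF v] by metis
  have [measurable]: "v \<in> borel_measurable borel" using cont by (rule borel_measurable_continuous_onI)
  have intv: "integrable lborel (\<lambda>x. norm (v x))"
    by (rule integrable_bounded_compact_support[of _ R V]) (use supp V in auto)
  let ?f = "form_integrand s m A u v"
  let ?G = "operator_integrand s m A u"
  have mf [measurable]: "form_integrand s m A g h \<in> borel_measurable (borel \<Otimes>\<^sub>M borel)"
    if "g \<in> borel_measurable borel" "h \<in> borel_measurable borel" for g h
    using that by (intro borel_measurable_form_integrand) auto
  have energy: "integrable (lborel \<Otimes>\<^sub>M lborel) (form_integrand s m A w w)"
    if "w \<in> finite_energy s m A" "w \<in> borel_measurable borel" for w
  proof -
    have "integrable lebesgue (form_integrand s m A w w)" using that by (simp add: finite_energy_def)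
    hence "integrable lborel (form_integrand s m A w w)"
      by (subst (asm) integrable_completion) (use mf[OF that(2,2)] in \<open>simp_all add: borel_prod\<close>)
    thus ?thesis by (simp add: lborel_prod)
  qed
  have "v \<in> finite_energy s m A"
    by (rule test_functions_finite_energy[OF s m continuous_A v])
  hence dom: "integrable (lborel \<Otimes>\<^sub>M lborel)
      (\<lambda>p. norm (form_integrand s m A u u p) + norm (form_integrand s m A v v p))"
    using fe by (intro Bochner_Integration.integrable_add integrable_norm energy) auto
  define e where "e n = inverse (real (Suc n))" for n
  have e: "\<And>n. 0 < e n" "e \<longlonglongrightarrow> 0" unfolding e_def using LIMSEQ_inverse_real_of_nat by auto
  define I where "I n z = (indicator (- ball 0 (e n)) z :: real)" for n and z :: "real^3"
  have [measurable]: "I n \<in> borel_measurable borel" for n unfolding I_def by measurable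
  define H where "H n p = I n (fst p - snd p) *\<^sub>R (?G (fst p) (snd p) * cnj (v (fst p)))" for n p
  have mH: "H n \<in> borel_measurable (lborel \<Otimes>\<^sub>M lborel)" for n
    unfolding H_def[abs_def] using measurable_operator_integrand
    by (simp cong: measurable_cong_sets) measurable
  have intH: "integrable (lborel \<Otimes>\<^sub>M lborel) (H n)" for n
  proof (rule Bochner_Integration.integrable_bound)
    show "integrable (lborel \<Otimes>\<^sub>M lborel) (\<lambda>(x, y). norm (v x) * (2 * M * (I n (x - y) * radial_kernel s m (x - y))))"
      using integrable_kernel_tail[OF e(1)[of n]]
      by (intro integrable_product_difference[OF intv, of "\<lambda>z. 2 * M * (I n z * radial_kernel s m z)"] integrable_mult_right)
         (simp add: I_def)
    show "AE p in lborel \<Otimes>\<^sub>M lborel. norm (H n p) \<le>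
        norm (case p of (x, y) \<Rightarrow> norm (v x) * (2 * M * (I n (x - y) * radial_kernel s m (x - y))))"
    proof (rule AE_I2)
      fix p :: "(real^3) \<times> (real^3)"
      obtain x y where p: "p = (x, y)" by fastforce
      have I0: "0 \<le> I n (x - y)" by (simp add: I_def)
      have "norm (H n p) = I n (x - y) * (norm (?G x y) * norm (v x))"
        using I0 by (simp add: H_def p norm_mult)
      also have "\<dots> \<le> I n (x - y) * ((2 * M * radial_kernel s m (x - y)) * norm (v x))"
        using I0 norm_operator_integrand_le by (intro mult_left_mono mult_right_mono) auto
      also have "\<dots> = norm (v x) * (2 * M * (I n (x - y) * radial_kernel s m (x - y)))" by (simp add: mult_ac)
      finally show "norm (H n p) \<le>
          norm (case p of (x, y) \<Rightarrow> norm (v x) * (2 * M * (I n (x - y) * radial_kernel s m (x - y))))"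
        unfolding p prod.case real_norm_def by (rule order_trans[OF _ abs_ge_self])
    qed
  qed (rule mH)
  have I_even: "I n (y - x) = I n (x - y)" for n x y
    by (simp add: I_def indicator_def norm_minus_commute)
  \<comment> \<open>The truncation is symmetric in \<open>x\<close> and \<open>y\<close>, so it respects the splitting of the integrand.\<close>
  have split: "I n (fst p - snd p) *\<^sub>R ?f p = H n p + (case p of (x, y) \<Rightarrow> H n (y, x))" for n p
    by (cases p) (simp add: form_integrand_eq_operator_integrand H_def I_even scaleR_add_right)
  have step: "(\<integral>p. I n (fst p - snd p) *\<^sub>R ?f p \<partial>(lborel \<Otimes>\<^sub>M lborel))
      = 2 * (\<integral>x. truncated_integral s m A u x (e n) * cnj (v x) \<partial>lborel)" for n
  proof -
    have inner: "(\<integral>y. H n (x, y) \<partial>lborel) = truncated_integral s m A u x (e n) * cnj (v x)" for x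
    proof -
      have "(\<integral>y. H n (x, y) \<partial>lborel) = (\<integral>y. (I n (x - y) *\<^sub>R ?G x y) * cnj (v x) \<partial>lborel)"
        by (simp add: H_def)
      also have "\<dots> = (\<integral>y. I n (x - y) *\<^sub>R ?G x y \<partial>lborel) * cnj (v x)"
        by (rule integral_mult_left_zero)
      finally show ?thesis unfolding truncated_integral_lborel I_def .
    qed
    have swap: "(\<integral>p. (case p of (x, y) \<Rightarrow> H n (y, x)) \<partial>(lborel \<Otimes>\<^sub>M lborel)) = (\<integral>p. H n p \<partial>(lborel \<Otimes>\<^sub>M lborel))"
      by (rule lborel_pair.integral_product_swap[OF mH])
    have "(\<integral>p. I n (fst p - snd p) *\<^sub>R ?f p \<partial>(lborel \<Otimes>\<^sub>M lborel))
        = (\<integral>p. H n p \<partial>(lborel \<Otimes>\<^sub>M lborel)) + (\<integral>p. (case p of (x, y) \<Rightarrow> H n (y, x)) \<partial>(lborel \<Otimes>\<^sub>M lborel))"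
      unfolding split by (intro Bochner_Integration.integral_add intH lborel_pair.integrable_product_swap)
    also have "\<dots> = 2 * (\<integral>p. H n p \<partial>(lborel \<Otimes>\<^sub>M lborel))" unfolding swap by simp
    also have "(\<integral>p. H n p \<partial>(lborel \<Otimes>\<^sub>M lborel)) = (\<integral>x. (\<integral>y. H n (x, y) \<partial>lborel) \<partial>lborel)"
      by (rule lborel_pair.integral_fst'[OF intH, symmetric])
    finally show ?thesis unfolding inner .
  qed
  have "(\<lambda>n. \<integral>p. I n (fst p - snd p) *\<^sub>R ?f p \<partial>(lborel \<Otimes>\<^sub>M lborel)) \<longlonglongrightarrow> (\<integral>p. ?f p \<partial>(lborel \<Otimes>\<^sub>M lborel))"
  proof (rule integral_dominated_convergence[OF _ _ dom])
    show meas: "?f \<in> borel_measurable (lborel \<Otimes>\<^sub>M lborel)"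
      using mf[of u v] by (simp cong: measurable_cong_sets)
    show "(\<lambda>p. I n (fst p - snd p) *\<^sub>R ?f p) \<in> borel_measurable (lborel \<Otimes>\<^sub>M lborel)" for n
      using meas by measurable
    show "AE p in lborel \<Otimes>\<^sub>M lborel. (\<lambda>n. I n (fst p - snd p) *\<^sub>R ?f p) \<longlonglongrightarrow> ?f p"
    proof (rule AE_I2)
      fix p :: "(real^3) \<times> (real^3)"
      obtain x y where p: "p = (x, y)" by fastforce
      \<comment> \<open>On the diagonal the integrand is \<open>0\<close>, so convergence holds there as well.\<close>
      show "(\<lambda>n. I n (fst p - snd p) *\<^sub>R ?f p) \<longlonglongrightarrow> ?f p"
      proof (cases "x = y")
        case False
        have "\<forall>\<^sub>F n in sequentially. e n < norm (x - y)"
          using e(2) False by (intro order_tendstoD) auto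
        hence "\<forall>\<^sub>F n in sequentially. ?f p = I n (fst p - snd p) *\<^sub>R ?f p"
          by eventually_elim (simp add: I_def p)
        thus ?thesis by (rule Lim_transform_eventually[OF tendsto_const])
      qed (simp add: p form_integrand_diagonal)
    qed
    show "AE p in lborel \<Otimes>\<^sub>M lborel. norm (I n (fst p - snd p) *\<^sub>R ?f p)
        \<le> norm (form_integrand s m A u u p) + norm (form_integrand s m A v v p)" for n
    proof (rule AE_I2)
      fix p
      have "norm (I n (fst p - snd p) *\<^sub>R ?f p) \<le> norm (?f p)"
        by (simp add: I_def indicator_def)
      thus "norm (I n (fst p - snd p) *\<^sub>R ?f p)
        \<le> norm (form_integrand s m A u u p) + norm (form_integrand s m A v v p)"
        by (rule order_trans[OF _ norm_form_integrand_le])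
    qed
  qed
  hence lim1: "(\<lambda>n. 2 * (\<integral>x. truncated_integral s m A u x (e n) * cnj (v x) \<partial>lborel))
      \<longlonglongrightarrow> (\<integral>p. ?f p \<partial>(lborel \<Otimes>\<^sub>M lborel))" unfolding step .
  obtain B where B: "\<And>x e. x \<in> cball 0 R \<Longrightarrow> 0 < e \<Longrightarrow> norm (truncated_integral s m A u x e) \<le> B"
    using truncated_integral_bounded[of R] by blast
  have "(\<lambda>n. \<integral>x. truncated_integral s m A u x (e n) * cnj (v x) \<partial>lborel)
      \<longlonglongrightarrow> (\<integral>x. singular_integral s m A u x * cnj (v x) \<partial>lborel)"
  proof (rule integral_dominated_convergence[where w = "\<lambda>x. B * norm (v x)"])
    show "integrable lborel (\<lambda>x. B * norm (v x))" using intv by (rule integrable_mult_right)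
    show "(\<lambda>x. truncated_integral s m A u x (e n) * cnj (v x)) \<in> borel_measurable lborel" for n
    proof -
      have "(\<lambda>x. truncated_integral s m A u x (e n)) \<in> borel_measurable borel"
        unfolding truncated_integral_lborel
        by (rule lborel.borel_measurable_lebesgue_integral)
           (use measurable_operator_integrand in \<open>simp add: case_prod_beta' cong: measurable_cong_sets\<close>)
      thus ?thesis by measurable
    qed
    show "AE x in lborel. (\<lambda>n. truncated_integral s m A u x (e n) * cnj (v x))
        \<longlonglongrightarrow> singular_integral s m A u x * cnj (v x)"
      by (intro AE_I2 tendsto_mult tendsto_const truncated_integral_sequence e)
    show "AE x in lborel. norm (truncated_integral s m A u x (e n) * cnj (v x)) \<le> B * norm (v x)" for n
    proof (rule AE_I2)
      fix x
      show "norm (truncated_integral s m A u x (e n) * cnj (v x)) \<le> B * norm (v x)"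
        using supp[of x] B[of x, OF _ e(1)[of n]]
        by (cases "x \<in> cball 0 R") (simp_all add: norm_mult mult_right_mono)
    qed
  qed measurable
  hence "(\<lambda>n. 2 * (\<integral>x. truncated_integral s m A u x (e n) * cnj (v x) \<partial>lborel))
      \<longlonglongrightarrow> 2 * (\<integral>x. singular_integral s m A u x * cnj (v x) \<partial>lborel)"
    by (rule tendsto_mult_left)
  with lim1 have "(\<integral>p. ?f p \<partial>(lborel \<Otimes>\<^sub>M lborel)) = 2 * (\<integral>x. singular_integral s m A u x * cnj (v x) \<partial>lborel)"
    by (rule LIMSEQ_unique)
  moreover have "(\<integral>p. ?f p \<partial>lebesgue) = (\<integral>p. ?f p \<partial>lborel)"
    by (rule integral_completion) (use mf[of u v] in \<open>simp add: borel_prod\<close>)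
  ultimately show ?thesis by (simp add: seminorm_form_def lborel_prod)
qed

end

lemma L_infinity_continuous_bounded:
  fixes u :: "'a::euclidean_space \<Rightarrow> 'b::real_normed_vector"
  assumes "u \<in> L_infinity" "continuous_on UNIV u"
  shows "\<exists>M. \<forall>x. norm (u x) \<le> M"
proof -
  obtain M where M: "AE x in lebesgue. norm (u x) \<le> M" using assms(1) by (auto simp: L_infinity_def)
  let ?S = "{x. M < norm (u x)}"
  have op: "open ?S"
    using assms(2) by (intro open_Collect_less continuous_intros)
  have "?S \<in> null_sets lebesgue"
  proof (subst AE_iff_null_sets)
    show "?S \<in> sets lebesgue" using op by (intro sets_completionI_sets) simp
    show "AE x in lebesgue. x \<notin> ?S" using M by eventually_elim simp
  qed
  hence "?S = {}" using open_not_negligible[OF op] by (auto simp: negligible_iff_null_sets)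
  thus ?thesis by (intro exI[of _ M]) (auto simp: not_less)
qed

lemma locally_integrable_bounded_on_balls:
  fixes h :: "'a::euclidean_space \<Rightarrow> 'b::euclidean_space"
  assumes "h \<in> borel_measurable borel" "\<And>R. \<exists>B. \<forall>x\<in>cball 0 R. norm (h x) \<le> B"
  shows "locally_integrable h"
  unfolding locally_integrable_def
proof (intro allI impI)
  fix K :: "'a set" assume K: "compact K"
  obtain R where "\<forall>x\<in>K. norm x \<le> R"
    using compact_imp_bounded[OF K] unfolding bounded_iff by (elim exE)
  hence R: "K \<subseteq> cball 0 R" by auto
  obtain B where B: "\<And>x. x \<in> cball 0 R \<Longrightarrow> norm (h x) \<le> B" using assms(2) by blast
  have [measurable]: "K \<in> sets borel" using K by (simp add: borel_compact)
  have "integrable lborel (\<lambda>x. indicator (cball 0 R) x *\<^sub>R h x)"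
  proof (rule integrable_bounded_compact_support[of _ R B])
    show "(\<lambda>x. indicator (cball 0 R) x *\<^sub>R h x) \<in> borel_measurable borel"
      by (intro borel_measurable_scaleR borel_measurable_indicator assms(1)) simp
  qed (use B in auto)
  hence "set_integrable lebesgue (cball 0 R) h"
    unfolding set_integrable_def by (subst integrable_completion) (use assms(1) in auto)
  thus "set_integrable lebesgue K h" by (rule set_integrable_subset) (use R in auto)
qed

theorem theorem4p2:
  fixes s m \<gamma> :: real
    and A :: "real^3 \<Rightarrow> real^3"
    and u f :: "real^3 \<Rightarrow> complex"
  assumes "0 < s" and "s < 1" and "0 < m"
    and "C_k 2 A"
    and "function_in_H_dual s m A f"
    and "weak_solution s m A f u"
    and "u \<in> L_infinity"
    and "0 < \<gamma>" and "\<gamma> \<le> 1" and "2 * s - 1 < \<gamma>"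
    and "C1_loc_holder \<gamma> u"
  shows "AE x in lebesgue. operator_defined_at s m A u x \<and> magnetic_operator s m A u x = f x"
proof -
  have A1: "C_k 1 A" using C_k_Suc_D[of 1 A] assms(4) by (simp only: Suc_1)
  have u1: "C_k 1 u" using assms(11) by (simp only: C1_loc_holder_def)
  note u_cont = C_k_imp_continuous_on[OF u1] and A_cont = C_k_imp_continuous_on[OF A1]
  obtain M where M: "\<And>x. norm (u x) \<le> M"
    using L_infinity_continuous_bounded[OF assms(7) u_cont] by blast
  interpret regular_bounded_function s m M \<gamma> A u
    using assms(1-3,8-11) A1 M by unfold_locales
  have [measurable]: "u \<in> borel_measurable borel" using u_cont by (rule borel_measurable_continuous_onI)
  define T where "T = singular_integral s m A u"
  have T_meas [measurable]: "T \<in> borel_measurable borel"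
    unfolding T_def by (rule measurable_singular_integral)
  have T_bounded: "\<exists>B. \<forall>x\<in>cball 0 R. norm (T x) \<le> B" for R
    using truncated_integral_bounded[of R] unfolding T_def by blast
  define c where "c = C_const s * m powr ((3 + 2 * s) / 2)"
  define d where "d = m powr (2 * s)"
  define h where "h x = of_real c * T x + of_real d * u x" for x
  have h_meas [measurable]: "h \<in> borel_measurable borel" unfolding h_def[abs_def] by measurable
  have h_bounded: "\<exists>B. \<forall>x\<in>cball 0 R. norm (h x) \<le> B" for R
  proof -
    obtain B where B: "\<And>x. x \<in> cball 0 R \<Longrightarrow> norm (T x) \<le> B" using T_bounded by blast
    have "norm (h x) \<le> \<bar>c\<bar> * B + \<bar>d\<bar> * M" if "x \<in> cball 0 R" for x
      unfolding h_def using B[OF that] M[of x]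
      by (intro order_trans[OF norm_triangle_ineq] add_mono) (auto simp: norm_mult mult_left_mono)
    thus ?thesis by blast
  qed
  have f_loc: "locally_integrable f" using assms(5) by (simp add: function_in_H_dual_def)
  have "locally_integrable h" by (rule locally_integrable_bounded_on_balls[OF h_meas h_bounded])
  hence loc: "locally_integrable (\<lambda>x. h x - f x)"
    using f_loc unfolding locally_integrable_def by (auto intro!: set_integral_diff(1))
  \<comment> \<open>\<open>h\<close> is the pointwise operator applied to \<open>u\<close>; the weak equation says that \<open>h - f\<close> is orthogonal to test functions.\<close>
  have "AE x in lebesgue. h x - f x = 0"
  proof (rule fundamental_lemma[OF loc])
    fix \<phi> :: "real^3 \<Rightarrow> complex" assume \<phi>: "\<phi> \<in> test_functions"
    have H: "\<phi> \<in> H_space s m A"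
      using test_functions_subset_H_space[OF assms(1-3) A_cont] \<phi> by blast
    obtain R V where supp: "\<And>x. x \<notin> cball 0 R \<Longrightarrow> \<phi> x = 0" and V: "0 \<le> V" "\<And>x. norm (\<phi> x) \<le> V"
      and cont: "continuous_on UNIV \<phi>"
      using test_function_props[OF \<phi>] by metis
    have [measurable]: "\<phi> \<in> borel_measurable borel" using cont by (rule borel_measurable_continuous_onI)
    have int: "integrable lebesgue (\<lambda>x. g x * cnj (\<phi> x))"
      if g: "g \<in> borel_measurable borel" "\<exists>B. \<forall>x\<in>cball 0 R. norm (g x) \<le> B" for g
    proof -
      have [measurable]: "g \<in> borel_measurable borel" by (rule g)
      obtain B where B: "\<And>x. x \<in> cball 0 R \<Longrightarrow> norm (g x) \<le> B" using g(2) by blast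
      have "integrable lborel (\<lambda>x. g x * cnj (\<phi> x))"
      proof (rule integrable_bounded_compact_support[of _ R "B * V"])
        show "norm (g x * cnj (\<phi> x)) \<le> B * V" if "x \<in> cball 0 R" for x
          using B[OF that] V order_trans[OF norm_ge_zero B[OF that]]
          by (auto simp: norm_mult intro!: mult_mono)
      qed (use supp in auto)
      thus ?thesis by (subst integrable_completion) auto
    qed
    have intT: "integrable lebesgue (\<lambda>x. T x * cnj (\<phi> x))" by (rule int[OF T_meas T_bounded])
    have intu: "integrable lebesgue (\<lambda>x. u x * cnj (\<phi> x))" by (rule int) (use M in auto)
    have intf: "integrable lebesgue (\<lambda>x. f x * cnj (\<phi> x))"
      using assms(5) H by (simp add: function_in_H_dual_def)
    have fe: "u \<in> finite_energy s m A" using assms(6) by (simp add: weak_solution_def H_space_def)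
    have "(LINT x|lebesgue. T x * cnj (\<phi> x)) = (LINT x|lborel. T x * cnj (\<phi> x))"
      by (rule integral_completion) measurable
    hence "seminorm_form s m A u \<phi> = 2 * Re (LINT x|lebesgue. T x * cnj (\<phi> x))"
      using seminorm_form_test_function[OF fe \<phi>] by (simp add: T_def)
    moreover have "inner_As s m A u \<phi> = L2_pairing f \<phi>"
      using assms(6) H by (simp add: weak_solution_def)
    ultimately have weak: "c * Re (LINT x|lebesgue. T x * cnj (\<phi> x)) + d * Re (LINT x|lebesgue. u x * cnj (\<phi> x))
        = Re (LINT x|lebesgue. f x * cnj (\<phi> x))"
      by (simp add: inner_As_def L2_pairing_def c_def d_def)
    have "(LINT x|lebesgue. (h x - f x) * cnj (\<phi> x))
        = (LINT x|lebesgue. of_real c * (T x * cnj (\<phi> x)) + of_real d * (u x * cnj (\<phi> x)) - f x * cnj (\<phi> x))"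
      by (simp add: h_def algebra_simps)
    also have "\<dots> = of_real c * (LINT x|lebesgue. T x * cnj (\<phi> x))
        + of_real d * (LINT x|lebesgue. u x * cnj (\<phi> x)) - (LINT x|lebesgue. f x * cnj (\<phi> x))"
      using intT intu intf by simp
    finally show "Re (LINT x|lebesgue. (h x - f x) * cnj (\<phi> x)) = 0"
      using weak by simp
  qed
  thus ?thesis
  proof eventually_elim
    case (elim x)
    have lim: "(truncated_integral s m A u x \<longlongrightarrow> T x) (at_right 0)"
      unfolding T_def by (rule truncated_integral_tendsto)
    hence "Lim (at_right 0) (truncated_integral s m A u x) = T x"
      by (intro tendsto_Lim) auto
    hence "magnetic_operator s m A u x = h x"
      by (simp add: magnetic_operator_def h_def c_def d_def)
    moreover have "operator_defined_at s m A u x"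
      unfolding operator_defined_at_def
      using set_integrable_operator_integrand lim by blast
    ultimately show ?case using elim by simp
  qed
qed

end
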